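(* Assume $Q>0$. Let $(\Omega,\mathcal{F},\mathbb{P})$ be a complete probability space with filtration $\{\mathcal{F}_k\}_{k\in\mathbb{Z}_+}$, let $W_k$ be $\mathcal{S}^n$-valued and $\mathcal{F}_k$-adapted with $\sum_{k=0}^\infty h_kW_k$ convergent with probability one, and let $\{P_k\}$ be generated by the robust value iteration defined in the context. (i) There exist $\delta_0>0$ and a compact set $\mathcal{S}_0\subset\mathcal{S}^n_+$ with nonempty interior and $P^*\in\mathcal{S}_0$ such that, if $|\Delta_k|<\delta_0(1+|P_k|)$ for all $k$, then with probability one there is $N\ge0$ with $P_k\in\mathcal{S}_0$ for all $k\ge N$. (ii) If $\Delta_k=\Delta_k(P_k)$ where $\Delta_k:\mathcal{S}^n\to\mathcal{S}^n$ are continuous and $\Delta_k\to0$ uniformly on every compact subset of $\mathcal{S}^n$, then $\lim_{k\to\infty}P_k=P^*$ with probability one.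
   Context: $A\in\mathbb{R}^{n\times n}$, $B\in\mathbb{R}^{n\times m}$ with $(A,B)$ stabilizable, $R=R^T>0$; $P^*$ is the unique symmetric positive definite solution of $0=A^TP+PA-PBR^{-1}B^TP+Q$. $\mathcal{S}^n$ is the space of real symmetric $n\times n$ matrices with induced norm $|\cdot|$, $\mathcal{S}^n_+$ its positive definite elements, and $\mathcal{R}(P)=A^TP+PA-PBR^{-1}B^TP+Q$. Step sizes $h_k>0$ satisfy $h_k\to0$ and $\sum_k h_k=\infty$; $\{B_q\}_{q\ge0}$ is an increasing real sequence with $B_0>0$ and $B_q\to\infty$. Robust value iteration: choose $P_0=P_0^T\ge0$ (in $\mathcal{S}^n_+$), set $q=0$, and for $k=0,1,2,\dots$ compute $P_{k+1/2}=P_k+h_k(\mathcal{R}(P_k)+\Delta_k+W_k)$, where $\Delta_k\in\mathcal{S}^n$ is a perturbation; if $|P_{k+1/2}|>B_q$ or $P_{k+1/2}$ is not positive definite, set $P_{k+1}=P_0$ and $q\leftarrow q+1$; otherwise set $P_{k+1}=P_{k+1/2}$. *)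

theory Defs
  imports "HOL-Analysis.Analysis" "HOL-Probability.Probability"
begin

type_synonym 'n mat = "real^'n^'n"

definition symm :: "'n::finite mat \<Rightarrow> bool" where
  "symm P \<longleftrightarrow> transpose P = P"

definition Sym :: "'n::finite mat set" where
  "Sym = {P. symm P}"

definition posdef :: "'n::finite mat \<Rightarrow> bool" where
  "posdef P \<longleftrightarrow> symm P \<and> (\<forall>x. x \<noteq> 0 \<longrightarrow> x \<bullet> (P *v x) > 0)"

definition Sym_pos :: "'n::finite mat set" where
  "Sym_pos = {P. posdef P}"

definition mnorm :: "'n::finite mat \<Rightarrow> real" where
  "mnorm P = onorm (\<lambda>x. P *v x)"

definition hurwitz :: "'n::finite mat \<Rightarrow> bool" where
  "hurwitz M \<longleftrightarrow> (\<forall>(lam::complex) (v::complex^'n).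
      v \<noteq> 0 \<and> (map_matrix complex_of_real M) *v v = lam *s v \<longrightarrow> Re lam < 0)"

definition stabilizable :: "'n::finite mat \<Rightarrow> real^'m^'n \<Rightarrow> bool" where
  "stabilizable A B \<longleftrightarrow> (\<exists>K::real^'n^'m. hurwitz (A + B ** K))"

definition riccati :: "'n::finite mat \<Rightarrow> real^'m^'n \<Rightarrow> 'n mat \<Rightarrow> 'm::finite mat \<Rightarrow> 'n mat \<Rightarrow> 'n mat" where
  "riccati A B Q R P = transpose A ** P + P ** A - P ** B ** matrix_inv R ** transpose B ** P + Q"

text \<open>Robust value iteration: state (P_k, q). D k P is the perturbation Delta_k evaluated at
  the current iterate, W k the noise term.\<close>
fun rvi :: "'n::finite mat \<Rightarrow> real^'m^'n \<Rightarrow> 'n mat \<Rightarrow> 'm::finite mat \<Rightarrow> (nat \<Rightarrow> real)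
    \<Rightarrow> (nat \<Rightarrow> real) \<Rightarrow> 'n mat \<Rightarrow> (nat \<Rightarrow> 'n mat \<Rightarrow> 'n mat) \<Rightarrow> (nat \<Rightarrow> 'n mat)
    \<Rightarrow> nat \<Rightarrow> 'n mat \<times> nat" where
  "rvi A B Q R h Bq P0 D W 0 = (P0, 0)"
| "rvi A B Q R h Bq P0 D W (Suc k) =
     (let (Pk, q) = rvi A B Q R h Bq P0 D W k;
          Ph = Pk + h k *\<^sub>R (riccati A B Q R Pk + D k Pk + W k)
      in if mnorm Ph > Bq q \<or> \<not> posdef Ph then (P0, Suc q) else (Ph, q))"

end

theory Submission
  imports Defs
begin

text \<open>Let S = B R^-1 B^T. Along the Riccati flow the Loewner intervals [a P*, b P*] with
  a < 1 < b are contracted, because the Riccati operator maps g P* to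
  (1 - g) (g P* S P* + Q), which is definite with the sign of 1 - g. Completing the square turns
  this into an exact statement about one Euler step, up to an error of second order in the step
  size; since the step sizes are not summable, the bounds a and b then improve until the
  perturbation stops them.

  The noise is removed by adding the tails of its convergent series to the iterates. A late restart
  from P0 therefore never leaves an interval around P* containing P0, so there are only finitely
  many resets; after the last one the iterates are bounded and positive definite, and the
  contraction applies first to the upper and then to the lower bound.\<close>

section \<open>Operator norm and quadratic forms\<close>

text \<open>The difficulty is uniformity: after the last reset the only a priori bound on the
  iterates is the current value of \<open>Bq\<close>, which depends on the sample path, whereas
  \<open>\<delta>0\<close> must not. What helps is that the upper margin \<open>(g - 1) * q\<close>
  grows linearly in \<open>g\<close>, and so does the admissible perturbation at level
  \<open>g\<close>; one tolerance calibrated at \<open>b\<close> therefore serves every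
  \<open>g \<ge> b\<close>. Passing between the iterates and the noise-free sequence costs at most
  \<open>s\<close> in either coefficient once the tails are small. This explains three nested
  intervals: \<open>P0\<close> lies in [3s, b - s], the noise-free sequence stays in [2s, b] after a
  late restart, and the iterates stay in [s, b + s], which is the compact set of part (i). The
  noise-free sequence need not be positive semidefinite, so its lower coefficient may start slightly
  below 0; half of \<open>Q\<close> is reserved to pay for that.\<close>

lemma norm_mult_le_mnorm: "norm (M *v x) \<le> mnorm M * norm x"
  unfolding mnorm_def by (rule onorm[OF matrix_vector_mul_bounded_linear])

lemma mnorm_nonneg: "0 \<le> mnorm M"
  unfolding mnorm_def by (rule onorm_pos_le[OF matrix_vector_mul_bounded_linear])

lemma mnorm_le:
  fixes M :: "'n::finite mat"
  assumes "\<And>x. norm (M *v x) \<le> c * norm x"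
  shows "mnorm M \<le> c"
  unfolding mnorm_def by (rule onorm_le) (rule assms)

lemma mnorm_add: "mnorm (M + N) \<le> mnorm M + mnorm N"
proof (rule mnorm_le)
  fix x
  have "norm ((M + N) *v x) \<le> norm (M *v x) + norm (N *v x)"
    by (simp add: matrix_vector_mult_add_rdistrib norm_triangle_ineq)
  also have "\<dots> \<le> (mnorm M + mnorm N) * norm x"
    using norm_mult_le_mnorm[of M x] norm_mult_le_mnorm[of N x] by (simp add: distrib_right)
  finally show "norm ((M + N) *v x) \<le> (mnorm M + mnorm N) * norm x" .
qed

lemma mnorm_scaleR: "mnorm (c *\<^sub>R M) = \<bar>c\<bar> * mnorm M"
  unfolding mnorm_def
  using onorm_scaleR[OF matrix_vector_mul_bounded_linear, of c M]
  by (simp add: scaleR_matrix_vector_assoc)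

lemma mnorm_diff: "mnorm (M - N) \<le> mnorm M + mnorm N"
  using mnorm_add[of M "- N"] mnorm_scaleR[of "-1" N] by simp

lemma mnorm_mult: "mnorm (M ** N) \<le> mnorm M * mnorm N"
proof (rule mnorm_le)
  fix x
  have "norm ((M ** N) *v x) \<le> mnorm M * norm (N *v x)"
    by (simp add: matrix_vector_mul_assoc[symmetric] norm_mult_le_mnorm)
  also have "\<dots> \<le> mnorm M * (mnorm N * norm x)"
    by (intro mult_left_mono norm_mult_le_mnorm mnorm_nonneg)
  finally show "norm ((M ** N) *v x) \<le> mnorm M * mnorm N * norm x" by simp
qed

lemma mnorm_le_norm: "mnorm M \<le> norm M"
proof (rule mnorm_le)
  fix x
  have "norm (M *v x) = L2_set (\<lambda>i. norm (M $ i \<bullet> x)) UNIV"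
    by (simp add: norm_vec_def matrix_mult_dot)
  also have "\<dots> \<le> L2_set (\<lambda>i. norm (M $ i) * norm x) UNIV"
    by (intro L2_set_mono) (simp_all add: Cauchy_Schwarz_ineq2)
  also have "\<dots> = norm M * norm x"
    by (simp add: norm_vec_def[of M] L2_set_left_distrib)
  finally show "norm (M *v x) \<le> norm M * norm x" .
qed

text \<open>\<open>norm\<close> is here the Euclidean norm of all entries. Together with
  \<open>mnorm_le_norm\<close> this makes the two norms equivalent, so that operator norm bounds
  give boundedness and convergence in the ambient topology; a crude constant suffices.\<close>

lemma norm_le_mnorm:
  fixes M :: "'n::finite mat"
  shows "norm M \<le> real CARD('n) ^ 2 * mnorm M"
proof -
  have "norm M \<le> (\<Sum>i\<in>UNIV. norm (M $ i))"
    unfolding norm_vec_def by (rule L2_set_le_sum) simp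
  also have "\<dots> \<le> (\<Sum>i\<in>(UNIV::'n set). \<Sum>j\<in>(UNIV::'n set). \<bar>M $ i $ j\<bar>)"
    by (intro sum_mono norm_le_l1_cart)
  also have "\<dots> \<le> (\<Sum>i\<in>(UNIV::'n set). \<Sum>j\<in>(UNIV::'n set). mnorm M)"
    unfolding mnorm_def by (intro sum_mono matrix_component_le_onorm)
  also have "\<dots> = real CARD('n) ^ 2 * mnorm M"
    by (simp add: power2_eq_square)
  finally show ?thesis .
qed

definition quadf :: "'n::finite mat \<Rightarrow> real^'n \<Rightarrow> real" where
  "quadf M x = x \<bullet> (M *v x)"

lemma quadf_add: "quadf (M + N) x = quadf M x + quadf N x"
  and quadf_diff: "quadf (M - N) x = quadf M x - quadf N x"
  and quadf_scaleR: "quadf (c *\<^sub>R M) x = c * quadf M x"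
  by (simp_all add: quadf_def matrix_vector_mult_add_rdistrib matrix_vector_mult_diff_rdistrib
      inner_add_right inner_diff_right flip: scaleR_matrix_vector_assoc)

lemma abs_quadf_le: "\<bar>quadf M x\<bar> \<le> mnorm M * (x \<bullet> x)"
proof -
  have "\<bar>quadf M x\<bar> \<le> norm x * norm (M *v x)"
    unfolding quadf_def by (rule Cauchy_Schwarz_ineq2)
  also have "\<dots> \<le> norm x * (mnorm M * norm x)"
    by (intro mult_left_mono norm_mult_le_mnorm) simp
  finally show ?thesis
    by (simp add: dot_square_norm power2_eq_square mult_ac)
qed

lemma symm_inner: "symm Z \<Longrightarrow> x \<bullet> (Z *v y) = (Z *v x) \<bullet> y"
  unfolding symm_def by (metis dot_lmul_matrix transpose_matrix_vector)

lemma symm_add: "symm X \<Longrightarrow> symm Y \<Longrightarrow> symm (X + Y)"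
  and symm_diff: "symm X \<Longrightarrow> symm Y \<Longrightarrow> symm (X - Y)"
  and symm_scaleR: "symm X \<Longrightarrow> symm (c *\<^sub>R X)"
  by (auto simp: symm_def transpose_def vec_eq_iff)

text \<open>Polarisation recovers the bilinear form of a symmetric matrix from its quadratic form.
  This is how a two-sided Loewner bound becomes an operator norm bound.\<close>

lemma symm_mnorm_le:
  assumes Z: "symm Z" and b: "\<And>x. \<bar>quadf Z x\<bar> \<le> c * (x \<bullet> x)"
  shows "mnorm Z \<le> c"
proof (rule mnorm_le)
  fix x
  define y a d where "y = Z *v x" and "a = norm x" and "d = norm y"
  show "norm (Z *v x) \<le> c * norm x"
  proof (cases "x = 0 \<or> y = 0")
    case True
    have "0 \<le> c" if "x \<noteq> 0"
    proof -
      have "0 \<le> c * (x \<bullet> x)" using b[of x] by linarith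
      moreover have "0 < x \<bullet> x" using that by simp
      ultimately show ?thesis by (simp add: zero_le_mult_iff del: inner_gt_zero_iff)
    qed
    with True show ?thesis by (cases "x = 0") (auto simp: y_def)
  next
    case False
    hence a: "a > 0" "d > 0" by (auto simp: a_def d_def)
    have xx: "x \<bullet> x = a^2" "y \<bullet> y = d^2" by (simp_all add: a_def d_def dot_square_norm)
    \<comment> \<open>Both vectors are scaled to the common length \<open>a * d\<close>, so that the
      parallelogram law loses nothing and the constant stays exactly \<open>c\<close>.\<close>
    define u v where "u = d *\<^sub>R x" and "v = a *\<^sub>R y"
    have uv: "u \<bullet> (Z *v v) = v \<bullet> (Z *v u)"
      using symm_inner[OF Z] by (metis inner_commute)
    have "4 * (v \<bullet> (Z *v u)) = quadf Z (u + v) - quadf Z (u - v)"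
      using uv by (simp add: quadf_def inner_add_left inner_add_right inner_diff_left inner_diff_right
        matrix_vector_right_distrib matrix_vector_mult_diff_distrib)
    also have "\<dots> \<le> c * ((u + v) \<bullet> (u + v)) + c * ((u - v) \<bullet> (u - v))"
      using b[of "u + v"] b[of "u - v"] by linarith
    also have "\<dots> = 2 * c * (u \<bullet> u + v \<bullet> v)"
      by (simp add: inner_add_left inner_add_right inner_diff_left inner_diff_right inner_commute
          algebra_simps)
    also have "\<dots> = 4 * c * (a^2 * d^2)"
      by (simp add: u_def v_def xx power2_eq_square)
    also have "v \<bullet> (Z *v u) = a * d * d^2"
      using xx(2) by (simp add: u_def v_def matrix_vector_mult_scaleR y_def)
    finally have "(a * d^2) * d \<le> (a * d^2) * (c * a)"
      by (simp add: power2_eq_square mult_ac)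
    moreover have "0 < a * d^2" using a by simp
    ultimately have "d \<le> c * a" by (rule mult_le_cancel_left_pos[THEN iffD1, rotated])
    thus ?thesis by (simp add: d_def a_def y_def)
  qed
qed

lemma posdef_coercive:
  fixes Q :: "'n::finite mat"
  assumes "posdef Q"
  obtains q where "q > 0" "\<And>x. q * (x \<bullet> x) \<le> quadf Q x"
proof -
  have "continuous_on (sphere 0 1) (quadf Q)"
    unfolding quadf_def by (intro continuous_intros linear_continuous_on matrix_vector_mul_bounded_linear)
  moreover have "sphere (0 :: real^'n) 1 \<noteq> {}" by simp
  ultimately obtain z where z: "z \<in> sphere 0 1" "\<And>y. y \<in> sphere 0 1 \<Longrightarrow> quadf Q z \<le> quadf Q y"
    using continuous_attains_inf[OF compact_sphere] by metis
  show thesis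
  proof
    have "z \<noteq> 0" using z(1) by auto
    thus "quadf Q z > 0" using assms by (simp add: posdef_def quadf_def)
  next
    fix x
    show "quadf Q z * (x \<bullet> x) \<le> quadf Q x"
    proof (cases "x = 0")
      case False
      define y where "y = (1 / norm x) *\<^sub>R x"
      have "quadf Q z \<le> quadf Q y" using False by (intro z(2)) (simp add: y_def)
      moreover have "quadf Q x = quadf Q y * (x \<bullet> x)"
        using False by (simp add: y_def quadf_def matrix_vector_mult_scaleR dot_square_norm power2_eq_square)
      ultimately show ?thesis by (simp add: mult_right_mono)
    qed (simp add: quadf_def)
  qed
qed

text \<open>With z = R^-1 B^T x the form becomes \<open>z \<bullet> (R *v z)\<close>, so positivity
  of \<open>R\<close> itself settles the sign; invertibility comes from the trivial kernel.\<close>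

lemma posdef_inverse_congruence_psd:
  assumes "posdef R"
  shows "symm (B ** matrix_inv R ** transpose B)"
    and "0 \<le> quadf (B ** matrix_inv R ** transpose B) x"
proof -
  have sR: "transpose R = R" using assms by (simp add: posdef_def symm_def)
  have "R *v x = 0 \<Longrightarrow> x = 0" for x
    using assms unfolding posdef_def by (metis inner_zero_right less_irrefl)
  hence "invertible R" 
    by (metis invertible_left_inverse matrix_left_invertible_ker)
  hence R: "R ** matrix_inv R = mat 1" "matrix_inv R ** R = mat 1"
    unfolding invertible_def matrix_inv_def by (metis (mono_tags, lifting) someI_ex)+
  have tR: "transpose (matrix_inv R) = matrix_inv R"
    by (metis R matrix_mul_assoc matrix_mul_lid matrix_mul_rid matrix_transpose_mul sR transpose_mat)
  thus "symm (B ** matrix_inv R ** transpose B)"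
    by (simp add: symm_def matrix_transpose_mul matrix_mul_assoc)
  define z where "z = matrix_inv R *v (transpose B *v x)"
  have "R *v z = transpose B *v x"
    by (simp add: z_def matrix_vector_mul_assoc R)
  moreover have "quadf (B ** matrix_inv R ** transpose B) x = x \<bullet> (B *v z)"
    by (simp add: quadf_def z_def matrix_vector_mul_assoc[symmetric])
  moreover have "x \<bullet> (B *v z) = (transpose B *v x) \<bullet> z"
    by (metis dot_lmul_matrix transpose_matrix_vector)
  ultimately have "quadf (B ** matrix_inv R ** transpose B) x = z \<bullet> (R *v z)"
    by (simp add: inner_commute)
  thus "0 \<le> quadf (B ** matrix_inv R ** transpose B) x"
    using assms unfolding posdef_def by (metis inner_zero_left less_imp_le order_refl)
qed

definition loewner_le :: "'n::finite mat \<Rightarrow> 'n mat \<Rightarrow> bool" (infix "\<preceq>" 50) where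
  "X \<preceq> Y \<longleftrightarrow> (\<forall>x. quadf X x \<le> quadf Y x)"

section \<open>One Euler step of the Riccati flow\<close>

text \<open>The constant \<open>q\<close> measures the strength of the contraction; \<open>r\<close>
  converts operator norm bounds into multiples of \<open>P\<close> in the Loewner order.\<close>

locale riccati_solution =
  fixes A Q S P :: "'n::finite mat" and q r :: real
  assumes symm_S: "symm S" and quadf_S: "\<And>x. 0 \<le> quadf S x"
    and symm_Q: "symm Q" and symm_P: "symm P"
    and q_pos: "0 < q" and q_le: "\<And>x. q * (x \<bullet> x) \<le> quadf Q x"
    and r_pos: "0 < r" and r_le: "\<And>x. r * (x \<bullet> x) \<le> quadf P x"
    and are: "transpose A ** P + P ** A - P ** S ** P + Q = 0"
begin

definition ric :: "'n mat \<Rightarrow> 'n mat" where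
  "ric Y = transpose A ** Y + Y ** A - Y ** S ** Y + Q"

lemma symm_ric:
  assumes "symm Y"
  shows "symm (ric Y)"
proof -
  have "symm (transpose A ** Y + Y ** A)"
    using assms by (simp add: symm_def matrix_transpose_mul transpose_def vec_eq_iff
        matrix_matrix_mult_def mult_ac)
  moreover have "symm (Y ** S ** Y)"
    using assms symm_S by (simp add: symm_def matrix_transpose_mul matrix_mul_assoc)
  ultimately show ?thesis
    unfolding ric_def by (rule symm_add[OF symm_diff symm_Q])
qed

lemma quadf_ric:
  assumes "symm Y"
  shows "quadf (ric Y) x = 2 * ((A *v x) \<bullet> (Y *v x)) - quadf S (Y *v x) + quadf Q x"
proof -
  have "quadf (transpose A ** Y) x = (A *v x) \<bullet> (Y *v x)"
    unfolding quadf_def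
    by (metis dot_lmul_matrix matrix_vector_mul_assoc transpose_matrix_vector transpose_transpose)
  moreover have "quadf (Y ** A) x = (A *v x) \<bullet> (Y *v x)"
    unfolding quadf_def
    by (metis assms inner_commute matrix_vector_mul_assoc symm_inner)
  moreover have "quadf (Y ** S ** Y) x = quadf S (Y *v x)"
    unfolding quadf_def
    by (metis assms matrix_vector_mul_assoc symm_inner)
  ultimately show ?thesis
    by (simp add: ric_def quadf_add quadf_diff)
qed

lemma are_quadf: "2 * ((A *v x) \<bullet> (P *v x)) = quadf S (P *v x) - quadf Q x"
  using quadf_ric[OF symm_P, of x] are by (simp add: ric_def quadf_def)

text \<open>Completing the square: the congruence by the matrix taking x to x + h v absorbs all
  terms of first order in Z, so only the definite term (1 - g) (...) is left at order h.\<close>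

lemma euler_step_identity:
  fixes Y E :: "'n mat" and g h :: real and x :: "real^'n"
  defines "Z \<equiv> Y - g *\<^sub>R P"
  defines "v \<equiv> A *v x - g *\<^sub>R (S *v (P *v x)) - (1/2) *\<^sub>R (S *v (Z *v x))"
  assumes Y: "symm Y"
  shows "quadf (Y + h *\<^sub>R (ric Y + E)) x - g * quadf P x =
    quadf Z (x + h *\<^sub>R v) - h^2 * quadf Z v
      + h * ((1 - g) * (g * quadf S (P *v x) + quadf Q x) + quadf E x)"
proof -
  define p z where "p = P *v x" and "z = Z *v x"
  have Z: "symm Z" unfolding Z_def by (intro symm_diff symm_scaleR Y symm_P)
  have Yx: "Y *v x = g *\<^sub>R p + z"
    by (simp add: p_def z_def Z_def matrix_vector_mult_diff_rdistrib scaleR_matrix_vector_assoc)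
  have Sz: "p \<bullet> (S *v z) = z \<bullet> (S *v p)"
    using symm_inner[OF symm_S, of p z] by (simp add: inner_commute)
  have S: "quadf S (Y *v x) = g^2 * quadf S p + 2 * g * (z \<bullet> (S *v p)) + quadf S z"
    using Sz unfolding Yx by (simp add: quadf_def matrix_vector_right_distrib matrix_vector_mult_scaleR
        inner_add_left inner_add_right power2_eq_square algebra_simps)
  \<comment> \<open>The factor 1/2 in \<open>v\<close> is doubled in
    \<open>2 * (v \<bullet> z)\<close> and then matches the quadratic term \<open>quadf S z\<close>
    of the Riccati operator exactly.\<close>
  have vz: "v \<bullet> z = (A *v x) \<bullet> z - g * (z \<bullet> (S *v p)) - quadf S z / 2"
    using inner_commute[of "S *v p" z] inner_commute[of "S *v z" z]
    by (simp add: v_def quadf_def inner_diff_left p_def z_def)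
  have xZ: "x \<bullet> (Z *v v) = v \<bullet> z"
    using symm_inner[OF Z, of x v] by (simp add: z_def inner_commute)
  have e1: "quadf Z (x + h *\<^sub>R v) = quadf Z x + 2 * h * (v \<bullet> z) + h^2 * quadf Z v"
    using xZ by (simp add: quadf_def matrix_vector_right_distrib matrix_vector_mult_scaleR
        inner_add_left inner_add_right power2_eq_square algebra_simps z_def)
  have e2: "quadf (ric Y) x = (1 - g) * (g * quadf S p + quadf Q x) + 2 * (v \<bullet> z)"
    using are_quadf[of x, folded p_def]
    unfolding quadf_ric[OF Y] S vz unfolding Yx
    by (simp add: inner_add_right power2_eq_square) (algebra)
  have e3: "quadf Z x = quadf Y x - g * quadf P x"
    by (simp add: Z_def quadf_diff quadf_scaleR)
  show ?thesis
    unfolding quadf_add quadf_scaleR e1 e2 e3 by (simp add: p_def algebra_simps)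
qed

text \<open>The first factor bounds \<open>mnorm Z\<close>, the squared bracket bounds the growth of
  \<open>v\<close> relative to \<open>x\<close>. The constant depends on \<open>g\<close> and
  \<open>Y\<close> only through the bounds \<open>G\<close> and \<open>L\<close>, so one value
  serves a whole trajectory.\<close>

definition step_const :: "real \<Rightarrow> real \<Rightarrow> real" where
  "step_const G L = (L + G * mnorm P) *
     (mnorm A + G * mnorm S * mnorm P + mnorm S * (L + G * mnorm P))^2"

lemma step_const_bound:
  fixes Y :: "'n mat" and g :: real and x :: "real^'n"
  defines "Z \<equiv> Y - g *\<^sub>R P"
  defines "v \<equiv> A *v x - g *\<^sub>R (S *v (P *v x)) - (1/2) *\<^sub>R (S *v (Z *v x))"
  assumes g: "\<bar>g\<bar> \<le> G" and L: "mnorm Y \<le> L"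
  shows "\<bar>quadf Z v\<bar> \<le> step_const G L * (x \<bullet> x)"
proof -
  define t k where "t = L + G * mnorm P"
    and "k = mnorm A + G * mnorm S * mnorm P + mnorm S * t"
  have nn: "0 \<le> mnorm A" "0 \<le> mnorm S" "0 \<le> mnorm P" "0 \<le> mnorm Y" "0 \<le> mnorm Z" "0 \<le> norm x"
    by (simp_all add: mnorm_nonneg)
  have Z: "mnorm Z \<le> t"
  proof -
    have "mnorm Z \<le> mnorm Y + \<bar>g\<bar> * mnorm P"
      unfolding Z_def using mnorm_diff[of Y "g *\<^sub>R P"] by (simp add: mnorm_scaleR)
    also have "\<dots> \<le> t" unfolding t_def using L g nn by (intro add_mono mult_right_mono)
    finally show ?thesis .
  qed
  have t: "0 \<le> t" using Z nn by linarith
  have "norm v \<le> norm (A *v x) + \<bar>g\<bar> * norm (S *v (P *v x)) + 1/2 * norm (S *v (Z *v x))"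
    using norm_triangle_ineq4[of "A *v x - g *\<^sub>R (S *v (P *v x))" "(1/2) *\<^sub>R (S *v (Z *v x))"]
      norm_triangle_ineq4[of "A *v x" "g *\<^sub>R (S *v (P *v x))"]
    unfolding v_def by simp
  also have "\<dots> \<le> mnorm A * norm x + G * (mnorm S * (mnorm P * norm x))
      + 1 * (mnorm S * (t * norm x))"
  proof (intro add_mono mult_mono order_trans[OF norm_mult_le_mnorm[of S]])
    show "norm (Z *v x) \<le> t * norm x"
      using norm_mult_le_mnorm[of Z x] mult_right_mono[OF Z] nn by fastforce
  qed (use g nn t norm_mult_le_mnorm in auto)
  also have "\<dots> = k * norm x" unfolding k_def by (simp add: algebra_simps)
  finally have v: "norm v \<le> k * norm x" .
  have "\<bar>quadf Z v\<bar> \<le> mnorm Z * (norm v)^2"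
    using abs_quadf_le[of Z v] by (simp add: dot_square_norm)
  also have "\<dots> \<le> t * (k * norm x)^2"
    using Z nn t v by (intro mult_mono power_mono) auto
  also have "\<dots> = step_const G L * (x \<bullet> x)"
    by (simp add: step_const_def t_def k_def dot_square_norm power_mult_distrib)
  finally show ?thesis .
qed

lemma quadf_P_bounds: "0 \<le> quadf P x" "quadf P x \<le> mnorm P * (x \<bullet> x)"
proof -
  have "0 \<le> r * (x \<bullet> x)" using r_pos by simp
  thus "0 \<le> quadf P x" using r_le[of x] by linarith
  show "quadf P x \<le> mnorm P * (x \<bullet> x)" using abs_quadf_le[of P x] by linarith
qed

text \<open>The congruence preserves the sign of \<open>Y - g P\<close>. The definite term, at most
  \<open>(1 - g) * q * (x \<bullet> x)\<close>, then has to pay for three things: the perturbation,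
  the second-order remainder, and lowering the coefficient at speed \<open>c\<close>.\<close>

lemma upper_step:
  assumes Y: "symm Y" "Y \<preceq> g *\<^sub>R P" and g: "1 \<le> g" "g \<le> G" and L: "mnorm Y \<le> L"
    and h: "0 \<le> h" and c: "0 \<le> c"
    and small: "c * mnorm P + mnorm E + h * step_const G L \<le> (g - 1) * q"
  shows "Y + h *\<^sub>R (ric Y + E) \<preceq> (g - h * c) *\<^sub>R P"
  unfolding loewner_le_def
proof
  fix x
  define Z v where "Z = Y - g *\<^sub>R P"
    and "v = A *v x - g *\<^sub>R (S *v (P *v x)) - (1/2) *\<^sub>R (S *v (Z *v x))"
  let ?n = "x \<bullet> x"
  have Z: "quadf Z y \<le> 0" for y
    using Y(2) by (simp add: Z_def loewner_le_def quadf_diff quadf_scaleR)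
  have b: "- (step_const G L * ?n) \<le> quadf Z v"
    using step_const_bound[of g G Y L x] g L unfolding Z_def v_def by force
  have "h * (c * quadf P x) \<le> h * (c * (mnorm P * ?n))"
    using h c quadf_P_bounds by (intro mult_left_mono) auto
  moreover have "- (h^2 * quadf Z v) \<le> h^2 * (step_const G L * ?n)"
    using mult_left_mono[OF b, of "h^2"] by simp
  moreover have "(1 - g) * (g * quadf S (P *v x) + quadf Q x) \<le> (1 - g) * (q * ?n)"
    using g q_le[of x] quadf_S[of "P *v x"] by (intro mult_left_mono_neg) (auto intro: add_increasing)
  hence "h * ((1 - g) * (g * quadf S (P *v x) + quadf Q x) + quadf E x)
      \<le> h * ((1 - g) * (q * ?n) + mnorm E * ?n)"
    using h abs_quadf_le[of E x] by (intro mult_left_mono) auto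
  moreover have "h * ?n * (c * mnorm P + mnorm E + h * step_const G L) \<le> h * ?n * ((g - 1) * q)"
    using h small by (intro mult_left_mono) auto
  ultimately have "quadf (Y + h *\<^sub>R (ric Y + E)) x - g * quadf P x + h * (c * quadf P x) \<le> 0"
    using Z[of "x + h *\<^sub>R v"] unfolding euler_step_identity[OF Y(1), of h E x g, folded Z_def, folded v_def]
    by (simp add: algebra_simps power2_eq_square)
  thus "quadf (Y + h *\<^sub>R (ric Y + E)) x \<le> quadf ((g - h * c) *\<^sub>R P) x"
    by (simp add: quadf_scaleR left_diff_distrib mult.assoc)
qed

text \<open>The mirror image of \<open>upper_step\<close>, except that \<open>g\<close> may be
  negative and then \<open>g * quadf S (P *v x)\<close> has the wrong sign. By \<open>g_low\<close>
  half of \<open>Q\<close> absorbs it, which is why the margin contains \<open>q / 2\<close>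
  only.\<close>

lemma lower_step:
  assumes Y: "symm Y" "g *\<^sub>R P \<preceq> Y" and g: "g \<le> 1" "\<bar>g\<bar> \<le> G" and L: "mnorm Y \<le> L"
    and g_low: "- g * (mnorm S * mnorm P ^ 2) \<le> q / 2"
    and h: "0 \<le> h" and c: "0 \<le> c"
    and small: "c * mnorm P + mnorm E + h * step_const G L \<le> (1 - g) * (q / 2)"
  shows "(g + h * c) *\<^sub>R P \<preceq> Y + h *\<^sub>R (ric Y + E)"
  unfolding loewner_le_def
proof
  fix x
  define w where "w = q / 2"
  define Z v where "Z = Y - g *\<^sub>R P"
    and "v = A *v x - g *\<^sub>R (S *v (P *v x)) - (1/2) *\<^sub>R (S *v (Z *v x))"
  let ?n = "x \<bullet> x"
  have Z: "0 \<le> quadf Z y" for y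
    using Y(2) by (simp add: Z_def loewner_le_def quadf_diff quadf_scaleR)
  have b: "quadf Z v \<le> step_const G L * ?n"
    using step_const_bound[of g G Y L x] g L unfolding Z_def v_def by force
  have "- (w * ?n) \<le> g * quadf S (P *v x)"
  proof (cases "0 \<le> g")
    case True
    have "0 \<le> w * ?n" "0 \<le> g * quadf S (P *v x)"
      using True quadf_S q_pos by (auto simp: w_def intro!: mult_nonneg_nonneg)
    thus ?thesis by linarith
  next
    case False
    have "quadf S (P *v x) \<le> mnorm S * (norm (P *v x))^2"
      using abs_quadf_le[of S "P *v x"] by (simp add: dot_square_norm)
    also have "\<dots> \<le> mnorm S * (mnorm P * norm x)^2"
      by (intro mult_left_mono power_mono norm_mult_le_mnorm mnorm_nonneg) auto
    also have "\<dots> = mnorm S * mnorm P ^ 2 * ?n"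
      by (simp add: dot_square_norm power_mult_distrib)
    finally have "- g * quadf S (P *v x) \<le> - g * (mnorm S * mnorm P ^ 2 * ?n)"
      using False by (intro mult_left_mono) auto
    also have "\<dots> \<le> w * ?n"
      using mult_right_mono[OF g_low[folded w_def], of ?n] by (simp add: mult_ac)
    finally show ?thesis by simp
  qed
  hence "w * ?n \<le> g * quadf S (P *v x) + quadf Q x"
    using q_le[of x] by (simp add: w_def)
  hence "(1 - g) * (w * ?n) \<le> (1 - g) * (g * quadf S (P *v x) + quadf Q x)"
    using g by (intro mult_left_mono) auto
  hence "h * ((1 - g) * (w * ?n) - mnorm E * ?n)
      \<le> h * ((1 - g) * (g * quadf S (P *v x) + quadf Q x) + quadf E x)"
    using h abs_quadf_le[of E x] by (intro mult_left_mono) auto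
  moreover have "h * (c * quadf P x) \<le> h * (c * (mnorm P * ?n))"
    using h c quadf_P_bounds by (intro mult_left_mono) auto
  moreover have "h^2 * quadf Z v \<le> h^2 * (step_const G L * ?n)"
    using mult_left_mono[OF b, of "h^2"] by simp
  moreover have "h * ?n * (c * mnorm P + mnorm E + h * step_const G L) \<le> h * ?n * ((1 - g) * (w))"
    using h small[folded w_def] by (intro mult_left_mono) auto
  ultimately have "0 \<le> quadf (Y + h *\<^sub>R (ric Y + E)) x - g * quadf P x - h * (c * quadf P x)"
    using Z[of "x + h *\<^sub>R v"] unfolding euler_step_identity[OF Y(1), of h E x g, folded Z_def, folded v_def]
    by (simp add: algebra_simps power2_eq_square)
  thus "quadf ((g + h * c) *\<^sub>R P) x \<le> quadf (Y + h *\<^sub>R (ric Y + E)) x"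
    by (simp add: quadf_scaleR distrib_right mult.assoc)
qed

section \<open>Asymptotics of the perturbed Euler scheme\<close>

lemma loewner_scale_mono:
  assumes "a \<le> b"
  shows "Y \<preceq> a *\<^sub>R P \<Longrightarrow> Y \<preceq> b *\<^sub>R P" and "b *\<^sub>R P \<preceq> Y \<Longrightarrow> a *\<^sub>R P \<preceq> Y"
proof -
  have "a * quadf P x \<le> b * quadf P x" for x
    using assms quadf_P_bounds(1) by (intro mult_right_mono)
  thus "Y \<preceq> a *\<^sub>R P \<Longrightarrow> Y \<preceq> b *\<^sub>R P" and "b *\<^sub>R P \<preceq> Y \<Longrightarrow> a *\<^sub>R P \<preceq> Y"
    unfolding loewner_le_def quadf_scaleR using order_trans by blast+
qed

lemma loewner_of_mnorm:
  assumes "mnorm X \<le> c * r"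
  shows "X \<preceq> c *\<^sub>R P" "- c *\<^sub>R P \<preceq> X"
proof -
  have "0 \<le> c * r" using assms mnorm_nonneg[of X] by linarith
  hence c: "0 \<le> c" using r_pos by (simp add: zero_le_mult_iff)
  have "\<bar>quadf X x\<bar> \<le> c * quadf P x" for x
  proof -
    have "\<bar>quadf X x\<bar> \<le> c * r * (x \<bullet> x)"
      using abs_quadf_le[of X x] mult_right_mono[OF assms, of "x \<bullet> x"] by simp
    also have "\<dots> \<le> c * quadf P x"
      using mult_left_mono[OF r_le c, of x] by (simp add: mult.assoc)
    finally show ?thesis .
  qed
  hence "- (c * quadf P x) \<le> quadf X x \<and> quadf X x \<le> c * quadf P x" for x
    by (simp add: abs_le_iff minus_le_iff)
  thus "X \<preceq> c *\<^sub>R P" "- c *\<^sub>R P \<preceq> X"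
    unfolding loewner_le_def quadf_scaleR by simp_all
qed

lemma mnorm_of_loewner:
  assumes "symm X" "X \<preceq> c *\<^sub>R P" "- c *\<^sub>R P \<preceq> X" "0 \<le> c"
  shows "mnorm X \<le> c * mnorm P"
proof (rule symm_mnorm_le[OF assms(1)])
  fix x
  have "quadf X x \<le> c * quadf P x" "- c * quadf P x \<le> quadf X x"
    using assms(2,3) unfolding loewner_le_def quadf_scaleR by blast+
  hence "\<bar>quadf X x\<bar> \<le> c * quadf P x"
    by (simp add: abs_le_iff minus_le_iff)
  also have "\<dots> \<le> c * (mnorm P * (x \<bullet> x))"
    using assms(4) quadf_P_bounds(2) by (intro mult_left_mono)
  finally show "\<bar>quadf X x\<bar> \<le> c * mnorm P * (x \<bullet> x)" by simp
qed

lemma loewner_add: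
  "X \<preceq> a *\<^sub>R P \<Longrightarrow> Y \<preceq> b *\<^sub>R P \<Longrightarrow> X + Y \<preceq> (a + b) *\<^sub>R P"
  "a *\<^sub>R P \<preceq> X \<Longrightarrow> b *\<^sub>R P \<preceq> Y \<Longrightarrow> (a + b) *\<^sub>R P \<preceq> X + Y"
  by (simp_all add: loewner_le_def quadf_add quadf_scaleR distrib_right add_mono)

lemma loewner_diff:
  "X \<preceq> a *\<^sub>R P \<Longrightarrow> b *\<^sub>R P \<preceq> Y \<Longrightarrow> X - Y \<preceq> (a - b) *\<^sub>R P"
  "a *\<^sub>R P \<preceq> X \<Longrightarrow> Y \<preceq> b *\<^sub>R P \<Longrightarrow> (a - b) *\<^sub>R P \<preceq> X - Y"
  by (simp_all add: loewner_le_def quadf_diff quadf_scaleR left_diff_distrib diff_mono)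

text \<open>The coefficient falls at speed \<open>c\<close> per unit of accumulated step size until
  it reaches \<open>b\<close>, and divergence of the step sums gives it enough time. The hypothesis
  on \<open>E\<close> is conditional on the level \<open>g\<close>, so that the perturbation may
  grow with the iterate.\<close>

lemma upper_eventually:
  fixes Y E :: "nat \<Rightarrow> 'n mat" and h :: "nat \<Rightarrow> real"
  assumes rec: "\<And>k. k \<ge> K \<Longrightarrow> Y (Suc k) = Y k + h k *\<^sub>R (ric (Y k) + E k)"
    and sym: "\<And>k. k \<ge> K \<Longrightarrow> symm (Y k)" and bdd: "\<And>k. k \<ge> K \<Longrightarrow> mnorm (Y k) \<le> L"
    and h: "\<And>k. 0 \<le> h k" "h \<longlonglongrightarrow> 0" "filterlim (\<lambda>n. \<Sum>k<n. h k) at_top sequentially"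
    and m: "0 < m"
    and E: "\<And>k g. k \<ge> K \<Longrightarrow> b \<le> g \<Longrightarrow> Y k \<preceq> g *\<^sub>R P \<Longrightarrow> mnorm (E k) + m \<le> (g - 1) * q"
  shows "\<forall>\<^sub>F k in sequentially. Y k \<preceq> b *\<^sub>R P"
proof -
  \<comment> \<open>Half of the margin \<open>m\<close> pays for the decrease of the coefficient,
    the other half for the second-order term. \<open>G\<close> is a level that holds from the start
    by boundedness; the summand 1 keeps the denominator positive.\<close>
  define G c where "G = max b (L / r)" and "c = m / (2 * (mnorm P + 1))"
  have p: "0 < mnorm P + 1" using mnorm_nonneg[of P] by simp
  have c: "0 < c" "c * mnorm P \<le> m / 2"
    using m p mnorm_nonneg[of P] by (simp_all add: c_def field_simps)
  have YG: "Y k \<preceq> G *\<^sub>R P" if "k \<ge> K" for k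
  proof (rule loewner_of_mnorm)
    have "L = (L / r) * r" using r_pos by simp
    also have "\<dots> \<le> G * r" using r_pos by (intro mult_right_mono) (auto simp: G_def)
    finally show "mnorm (Y k) \<le> G * r" using bdd[OF that] by simp
  qed
  have "(\<lambda>k. h k * step_const G L) \<longlonglongrightarrow> 0"
    using tendsto_mult_left_zero[OF h(2)] by blast
  hence "\<forall>\<^sub>F k in sequentially. h k * step_const G L < m / 2"
    using m by (intro order_tendstoD(2)[of _ 0]) auto
  then obtain N0 where N0: "\<And>k. k \<ge> N0 \<Longrightarrow> h k * step_const G L < m / 2"
    by (auto simp: eventually_sequentially)
  define N where "N = max K N0"
  define H where "H k = (\<Sum>j<k. h j)" for k
  have claim: "Y k \<preceq> max b (G - c * (H k - H N)) *\<^sub>R P" if "k \<ge> N" for k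
    using that
  proof (induction k rule: dec_induct)
    case base
    have "Y N \<preceq> G *\<^sub>R P" by (rule YG) (simp add: N_def)
    thus ?case by (simp add: G_def)
  next
    case (step k)
    define g where "g = max b (G - c * (H k - H N))"
    have kK: "k \<ge> K" "k \<ge> N0" using step(1) by (auto simp: N_def)
    have gq: "mnorm (E k) + m \<le> (g - 1) * q"
      using step.IH by (intro E kK) (auto simp: g_def)
    \<comment> \<open>The positive margin forces \<open>g\<close> above 1, as
      \<open>upper_step\<close> requires.\<close>
    have "0 < (g - 1) * q" using gq m mnorm_nonneg[of "E k"] by linarith
    hence g1: "1 \<le> g" using q_pos by (simp add: zero_less_mult_iff)
    have "H N \<le> H k" unfolding H_def using step(1) h(1) by (intro sum_mono2) auto
    hence gG: "g \<le> G" using c(1) by (auto simp: g_def G_def)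
    have "Y (Suc k) \<preceq> (g - h k * c) *\<^sub>R P"
      unfolding rec[OF kK(1)]
      by (rule upper_step[OF sym[OF kK(1)] _ g1 gG bdd[OF kK(1)] h(1)])
         (use step.IH c gq N0[OF kK(2)] in \<open>auto simp: g_def\<close>)
    moreover have "g - h k * c \<le> max b (G - c * (H (Suc k) - H N))"
      using mult_nonneg_nonneg[OF less_imp_le[OF c(1)] h(1)[of k]]
      by (auto simp: g_def H_def algebra_simps max_def)
    ultimately show ?case by (rule loewner_scale_mono(1)[rotated])
  qed
  have "\<forall>\<^sub>F k in sequentially. H k \<ge> H N + (G - b) / c"
    using h(3) unfolding H_def filterlim_at_top by blast
  with eventually_ge_at_top[of N] show ?thesis
  proof eventually_elim
    case (elim k)
    have "G - b \<le> c * (H k - H N)" using elim(2) c(1) by (simp add: field_simps)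
    hence "max b (G - c * (H k - H N)) \<le> b" by simp
    thus ?case using claim[OF elim(1)] loewner_scale_mono(1) by blast
  qed
qed

text \<open>The coefficient climbs from \<open>- d\<close> to \<open>a\<close>. The bound on
  \<open>d\<close> ensures the side condition \<open>g_low\<close> of \<open>lower_step\<close> at
  every level on the way. The bound on \<open>E\<close> is absolute here, in contrast to
  \<open>upper_eventually\<close>.\<close>

lemma lower_eventually:
  fixes Y E :: "nat \<Rightarrow> 'n mat" and h :: "nat \<Rightarrow> real"
  assumes rec: "\<And>k. k \<ge> K \<Longrightarrow> Y (Suc k) = Y k + h k *\<^sub>R (ric (Y k) + E k)"
    and sym: "\<And>k. k \<ge> K \<Longrightarrow> symm (Y k)" and bdd: "\<And>k. k \<ge> K \<Longrightarrow> mnorm (Y k) \<le> L"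
    and h: "\<And>k. 0 \<le> h k" "h \<longlonglongrightarrow> 0" "filterlim (\<lambda>n. \<Sum>k<n. h k) at_top sequentially"
    and m: "0 < m"
    and E: "\<And>k. k \<ge> K \<Longrightarrow> mnorm (E k) + m \<le> (1 - a) * (q / 2)"
    and d: "0 \<le> d" "- d \<le> a" "d * (mnorm S * mnorm P ^ 2) \<le> q / 2"
    and start: "\<And>k. k \<ge> K \<Longrightarrow> - d *\<^sub>R P \<preceq> Y k"
  shows "\<forall>\<^sub>F k in sequentially. a *\<^sub>R P \<preceq> Y k"
proof -
  define G c where "G = 1 + d" and "c = m / (2 * (mnorm P + 1))"
  have p: "0 < mnorm P + 1" using mnorm_nonneg[of P] by simp
  have c: "0 < c" "c * mnorm P \<le> m / 2"
    using m p mnorm_nonneg[of P] by (simp_all add: c_def field_simps)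
  have "0 < (1 - a) * (q / 2)" using E[of K] m mnorm_nonneg[of "E K"] by simp
  hence a1: "a \<le> 1" using q_pos by (simp add: zero_less_mult_iff)
  have "(\<lambda>k. h k * step_const G L) \<longlonglongrightarrow> 0"
    using tendsto_mult_left_zero[OF h(2)] by blast
  hence "\<forall>\<^sub>F k in sequentially. h k * step_const G L < m / 2"
    using m by (intro order_tendstoD(2)[of _ 0]) auto
  then obtain N0 where N0: "\<And>k. k \<ge> N0 \<Longrightarrow> h k * step_const G L < m / 2"
    by (auto simp: eventually_sequentially)
  define N where "N = max K N0"
  define H where "H k = (\<Sum>j<k. h j)" for k
  have claim: "min a (- d + c * (H k - H N)) *\<^sub>R P \<preceq> Y k" if "k \<ge> N" for k
    using that
  proof (induction k rule: dec_induct)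
    case base
    have "- d *\<^sub>R P \<preceq> Y N" by (rule start) (simp add: N_def)
    thus ?case using d by (simp add: min_def)
  next
    case (step k)
    define g where "g = min a (- d + c * (H k - H N))"
    have kK: "k \<ge> K" "k \<ge> N0" using step(1) by (auto simp: N_def)
    have "H N \<le> H k" unfolding H_def using step(1) h(1) by (intro sum_mono2) auto
    hence gd: "- d \<le> g" using c(1) d by (auto simp: g_def)
    have ga: "g \<le> a" by (simp add: g_def)
    \<comment> \<open>The margin is smallest at the target level \<open>a\<close>, so the hypothesis
      on \<open>E\<close> at \<open>a\<close> covers all levels below it.\<close>
    have "(1 - a) * (q / 2) \<le> (1 - g) * (q / 2)"
      using ga q_pos by (intro mult_right_mono) auto
    hence gq: "mnorm (E k) + m \<le> (1 - g) * (q / 2)"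
      using E[OF kK(1)] by linarith
    have "- g * (mnorm S * mnorm P ^ 2) \<le> d * (mnorm S * mnorm P ^ 2)"
      using gd by (intro mult_right_mono mult_nonneg_nonneg mnorm_nonneg) auto
    hence gl: "- g * (mnorm S * mnorm P ^ 2) \<le> q / 2" using d by linarith
    have gG: "\<bar>g\<bar> \<le> G" "g \<le> 1" using gd ga a1 d by (auto simp: G_def)
    have "(g + h k * c) *\<^sub>R P \<preceq> Y (Suc k)"
      unfolding rec[OF kK(1)]
      by (rule lower_step[OF sym[OF kK(1)] _ gG(2,1) bdd[OF kK(1)] gl h(1)])
         (use step.IH c gq N0[OF kK(2)] in \<open>auto simp: g_def\<close>)
    moreover have "min a (- d + c * (H (Suc k) - H N)) \<le> g + h k * c"
      using mult_nonneg_nonneg[OF less_imp_le[OF c(1)] h(1)[of k]]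
      by (auto simp: g_def H_def algebra_simps min_def)
    ultimately show ?case by (rule loewner_scale_mono(2)[rotated])
  qed
  have "\<forall>\<^sub>F k in sequentially. H k \<ge> H N + (a + d) / c"
    using h(3) unfolding H_def filterlim_at_top by blast
  with eventually_ge_at_top[of N] show ?thesis
  proof eventually_elim
    case (elim k)
    have "a + d \<le> c * (H k - H N)" using elim(2) c(1) by (simp add: field_simps)
    hence "a \<le> min a (- d + c * (H k - H N))" by simp
    thus ?case using claim[OF elim(1)] loewner_scale_mono(2) by blast
  qed
qed

text \<open>The Riccati operator is quadratic, hence Lipschitz on bounded sets;
  \<open>mnorm T \<le> 1\<close> reduces the term quadratic in \<open>T\<close> to a linear one. It
  controls the error of evaluating the operator at a shifted iterate.\<close>

lemma mnorm_ric_diff: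
  assumes X: "mnorm X \<le> L" and T: "mnorm T \<le> 1"
  shows "mnorm (ric X - ric (X + T))
    \<le> mnorm T * (mnorm (transpose A) + mnorm A + mnorm S * (2 * L + 1))"
proof -
  have "ric X - ric (X + T) =
      X ** (S ** T) + T ** (S ** X) + T ** (S ** T) - (transpose A ** T + T ** A)"
    by (simp add: ric_def matrix_eq matrix_vector_mul_assoc[symmetric] matrix_vector_mult_diff_rdistrib
        matrix_vector_mult_add_rdistrib matrix_vector_right_distrib)
  hence "mnorm (ric X - ric (X + T)) \<le>
      mnorm (X ** (S ** T)) + mnorm (T ** (S ** X)) + mnorm (T ** (S ** T))
      + (mnorm (transpose A ** T) + mnorm (T ** A))"
    using mnorm_diff[of "X ** (S ** T) + T ** (S ** X) + T ** (S ** T)" "transpose A ** T + T ** A"]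
      mnorm_add[of "X ** (S ** T) + T ** (S ** X)" "T ** (S ** T)"]
      mnorm_add[of "X ** (S ** T)" "T ** (S ** X)"] mnorm_add[of "transpose A ** T" "T ** A"]
    by simp
  also have "\<dots> \<le> L * (mnorm S * mnorm T) + mnorm T * (mnorm S * L) + 1 * (mnorm S * mnorm T)
      + (mnorm (transpose A) * mnorm T + mnorm T * mnorm A)"
    using order_trans[OF mnorm_nonneg X]
    by (intro add_mono order_trans[OF mnorm_mult] mult_mono X T order_refl mult_nonneg_nonneg
        mnorm_nonneg) (auto intro: order_trans[OF mnorm_mult] mult_left_mono[OF X] mnorm_nonneg)
  also have "\<dots> = mnorm T * (mnorm (transpose A) + mnorm A + mnorm S * (2 * L + 1))"
    by (simp add: algebra_simps)
  finally show ?thesis .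
qed

section \<open>Loewner intervals around the Riccati solution\<close>

definition box :: "real \<Rightarrow> real \<Rightarrow> 'n mat set" where
  "box a b = {X. symm X \<and> a *\<^sub>R P \<preceq> X \<and> X \<preceq> b *\<^sub>R P}"

lemma box_mnorm:
  assumes "X \<in> box a b" "0 \<le> a" "0 \<le> b"
  shows "mnorm X \<le> b * mnorm P"
proof (rule mnorm_of_loewner)
  show "- b *\<^sub>R P \<preceq> X"
    using assms by (intro loewner_scale_mono(2)[of "- b" a]) (auto simp: box_def)
qed (use assms in \<open>auto simp: box_def\<close>)

lemma box_posdef:
  assumes "X \<in> box a b" "0 < a"
  shows "posdef X"
proof -
  have "0 < x \<bullet> (X *v x)" if "x \<noteq> 0" for x
  proof -
    have "0 < a * (r * (x \<bullet> x))" using assms(2) r_pos that by simp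
    also have "\<dots> \<le> a * quadf P x" using r_le assms(2) by (intro mult_left_mono) auto
    also have "\<dots> \<le> quadf X x" using assms(1) by (auto simp: box_def loewner_le_def quadf_scaleR)
    finally show ?thesis by (simp add: quadf_def)
  qed
  with assms(1) show ?thesis by (simp add: posdef_def box_def)
qed

text \<open>The three multiples of \<open>s\<close> leave room for two shifts by a noise tail, with
  the final lower coefficient \<open>s\<close> still positive. The bounds
  \<open>s \<le> 1 / 4\<close> and \<open>3 \<le> b\<close> keep both ends away from 1, where the
  contraction vanishes.\<close>

lemma posdef_in_box:
  assumes X: "posdef X"
  obtains s b where "0 < s" "s \<le> 1 / 4" "3 \<le> b" "X \<in> box (3 * s) (b - s)"
proof -
  obtain t where t: "0 < t" "\<And>x. t * (x \<bullet> x) \<le> quadf X x" using posdef_coercive[OF X] by blast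
  define s b where "s = min (1 / 4) (t / 3 / (mnorm P + 1))" and "b = 4 + mnorm X / r"
  have p: "0 < mnorm P + 1" using mnorm_nonneg[of P] by simp
  have s: "0 < s" "s \<le> 1 / 4" unfolding s_def using t p by (simp_all only: min.cobounded1) simp
  have "3 * s * (mnorm P + 1) \<le> 3 * (t / 3 / (mnorm P + 1)) * (mnorm P + 1)"
    using p by (intro mult_right_mono mult_left_mono) (auto simp: s_def)
  also have "\<dots> = t" using p by (simp add: field_simps)
  finally have st: "3 * s * mnorm P \<le> t" using s by (simp add: distrib_left)
  have "3 * s * quadf P x \<le> quadf X x" for x
  proof -
    have "3 * s * quadf P x \<le> 3 * s * (mnorm P * (x \<bullet> x))"
      using s quadf_P_bounds(2) by (intro mult_left_mono) auto
    also have "\<dots> \<le> t * (x \<bullet> x)" using mult_right_mono[OF st, of "x \<bullet> x"] by simp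
    finally show ?thesis using t(2)[of x] by linarith
  qed
  hence low: "(3 * s) *\<^sub>R P \<preceq> X" by (simp add: loewner_le_def quadf_scaleR)
  have "mnorm X / r * r \<le> (b - s) * r" using s r_pos by (intro mult_right_mono) (auto simp: b_def)
  hence up: "X \<preceq> (b - s) *\<^sub>R P" using r_pos by (intro loewner_of_mnorm) simp
  have "3 \<le> b" using mnorm_nonneg[of X] r_pos by (simp add: b_def)
  thus thesis using that s low up X by (simp add: box_def posdef_def)
qed

text \<open>For \<open>s \<le> 1\<close> the factor \<open>1 + (b + 1) * mnorm P\<close> bounds 1 +
  |X| on \<open>box s (b + s)\<close>, so a perturbation within the relative tolerance is at most
  \<open>q / 8\<close> there.\<close>

definition tolerance :: "real \<Rightarrow> real" where
  "tolerance b = q / (8 * (1 + (b + 1) * mnorm P))"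

lemma tolerance_pos: "3 \<le> b \<Longrightarrow> 0 < tolerance b"
  and tolerance_eq: "3 \<le> b \<Longrightarrow> tolerance b * (1 + (b + 1) * mnorm P) = q / 8"
proof -
  assume "3 \<le> b"
  hence p: "0 < 1 + (b + 1) * mnorm P" using mnorm_nonneg[of P] by (intro add_pos_nonneg) auto
  thus "0 < tolerance b" using q_pos by (simp add: tolerance_def)
  show "tolerance b * (1 + (b + 1) * mnorm P) = q / 8"
    using p by (simp only: tolerance_def) (simp add: divide_simps)
qed

lemma box_nhd:
  assumes "symm X" "dist X P < e" "e \<le> (1 - a) * r" "e \<le> (b - 1) * r"
  shows "X \<in> box a b"
proof -
  have m: "mnorm (X - P) \<le> e" using mnorm_le_norm[of "X - P"] assms(2) by (simp add: dist_norm)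
  have PP: "1 *\<^sub>R P \<preceq> P" "P \<preceq> 1 *\<^sub>R P" by (simp_all add: loewner_le_def)
  have "X - P \<preceq> (b - 1) *\<^sub>R P" "- (1 - a) *\<^sub>R P \<preceq> X - P"
    using m assms(3,4) by (intro loewner_of_mnorm; linarith)+
  from loewner_add(1)[OF this(1) PP(2)] loewner_add(2)[OF this(2) PP(1)]
  show ?thesis using assms(1) by (simp add: box_def)
qed

end

lemma closed_symm: "closed {X :: 'n::finite mat. symm X}"
proof -
  have "{X :: 'n mat. symm X} = (\<Inter>i j. {X. X $ j $ i = X $ i $ j})"
    by (auto simp: symm_def transpose_def vec_eq_iff)
  also have "closed \<dots>"
    by (intro closed_INT ballI closed_Collect_eq continuous_intros)
  finally show ?thesis .
qed

lemma continuous_on_quadf: "continuous_on U (\<lambda>X. quadf X x)"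
proof -
  have "linear (\<lambda>X. quadf X x)"
    by (rule linearI) (simp_all add: quadf_add quadf_scaleR)
  thus ?thesis by (simp add: linear_continuous_on linear_conv_bounded_linear)
qed

context riccati_solution
begin

lemma compact_box:
  assumes "0 \<le> a" "0 \<le> b"
  shows "compact (box a b)"
proof (rule compact_eq_bounded_closed[THEN iffD2, OF conjI])
  have "norm X \<le> real CARD('n) ^ 2 * (b * mnorm P)" if "X \<in> box a b" for X
    by (rule order_trans[OF norm_le_mnorm]) (intro mult_left_mono box_mnorm[OF that assms] zero_le_power2)
  thus "bounded (box a b)" unfolding bounded_iff by blast
  have "box a b = {X. symm X} \<inter> ((\<Inter>x. {X. quadf (a *\<^sub>R P) x \<le> quadf X x})
      \<inter> (\<Inter>x. {X. quadf X x \<le> quadf (b *\<^sub>R P) x}))"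
    by (auto simp: box_def loewner_le_def)
  thus "closed (box a b)"
    by (auto intro!: closed_Int closed_symm closed_INT closed_Collect_le continuous_on_quadf
        continuous_on_const)
qed

end

section \<open>The iteration with resets\<close>

text \<open>PP and qq are the iterates and the truncation index along a single sample path. Adding the
  tail of the noise series to PP gives a sequence Y without noise.\<close>

locale robust_vi = riccati_solution A Q S P q r
  for A Q S P :: "'n::finite mat" and q r :: real +
  fixes h Bq :: "nat \<Rightarrow> real" and P0 :: "'n mat" and D :: "nat \<Rightarrow> 'n mat \<Rightarrow> 'n mat"
    and W PP :: "nat \<Rightarrow> 'n mat" and qq :: "nat \<Rightarrow> nat" and s b :: real
  assumes h_pos: "\<And>k. 0 < h k" and h_lim: "h \<longlonglongrightarrow> 0"
    and h_div: "filterlim (\<lambda>n. \<Sum>k<n. h k) at_top sequentially"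
    and Bq_lim: "filterlim Bq at_top sequentially"
    and P0_pd: "posdef P0"
    and symm_W: "\<And>k. symm (W k)" and summ_W: "summable (\<lambda>k. h k *\<^sub>R W k)"
    and symm_D: "\<And>k X. symm X \<Longrightarrow> symm (D k X)"
    and PP_0: "PP 0 = P0"
    and reset: "\<And>k. (let X = PP k + h k *\<^sub>R (ric (PP k) + D k (PP k) + W k)
        in if mnorm X > Bq (qq k) \<or> \<not> posdef X then PP (Suc k) = P0 \<and> qq (Suc k) = Suc (qq k)
           else PP (Suc k) = X \<and> qq (Suc k) = qq k)"
    and s: "0 < s" "s \<le> 1 / 4" and b: "3 \<le> b"
    and P0_box: "P0 \<in> box (3 * s) (b - s)"
begin

definition half :: "nat \<Rightarrow> 'n mat" where
  "half k = PP k + h k *\<^sub>R (ric (PP k) + D k (PP k) + W k)"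

lemma step_cases:
  obtains (Reset) "mnorm (half k) > Bq (qq k) \<or> \<not> posdef (half k)"
      "PP (Suc k) = P0" "qq (Suc k) = Suc (qq k)"
  | (Keep) "mnorm (half k) \<le> Bq (qq k)" "posdef (half k)" "PP (Suc k) = half k" "qq (Suc k) = qq k"
  using reset[of k] unfolding half_def[symmetric] Let_def
  by (cases "mnorm (half k) > Bq (qq k) \<or> \<not> posdef (half k)") auto

lemma posdef_PP: "posdef (PP k)"
  by (induction k) (metis PP_0 P0_pd, metis P0_pd step_cases)

lemma symm_PP: "symm (PP k)"
  using posdef_PP by (simp add: posdef_def)

text \<open>Zero is written as a multiple of \<open>P\<close> so that \<open>box\<close> and
  \<open>loewner_add\<close> apply directly.\<close>

lemma PP_nonneg: "0 *\<^sub>R P \<preceq> PP k"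
proof -
  have "0 \<le> quadf (PP k) x" for x
    using posdef_PP[of k] by (cases "x = 0") (auto simp: posdef_def quadf_def intro: less_imp_le)
  thus ?thesis by (simp only: loewner_le_def quadf_scaleR) simp
qed

lemma mnorm_PP:
  assumes "PP k \<preceq> c *\<^sub>R P" "0 \<le> c"
  shows "mnorm (PP k) \<le> c * mnorm P"
  using box_mnorm[of "PP k" 0 c] assms PP_nonneg symm_PP by (simp add: box_def)

section \<open>Removing the noise by the tails of its series\<close>

definition T :: "nat \<Rightarrow> 'n mat" where
  "T k = (\<Sum>j. h j *\<^sub>R W j) - (\<Sum>j<k. h j *\<^sub>R W j)"

lemma T_Suc: "T k = h k *\<^sub>R W k + T (Suc k)"
  by (simp add: T_def)

lemma symm_T: "symm (T k)"
proof -
  have sum: "symm (\<Sum>j<n. h j *\<^sub>R W j)" for n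
  proof (induction n)
    case 0
    show ?case by (simp add: symm_def transpose_def vec_eq_iff)
  next
    case (Suc n)
    thus ?case by (simp add: symm_add symm_scaleR symm_W)
  qed
  have "(\<Sum>j. h j *\<^sub>R W j) \<in> {X. symm X}"
    by (rule closed_sequentially[OF closed_symm _ summable_LIMSEQ[OF summ_W]]) (simp add: sum)
  thus ?thesis unfolding T_def by (simp add: symm_diff sum)
qed

lemma T_lim: "(\<lambda>k. mnorm (T k)) \<longlonglongrightarrow> 0"
proof (rule tendsto_sandwich[of "\<lambda>_. 0" _ _ "\<lambda>k. norm (T k)"])
  have "T \<longlonglongrightarrow> (\<Sum>j. h j *\<^sub>R W j) - (\<Sum>j. h j *\<^sub>R W j)"
    unfolding T_def by (intro tendsto_intros summable_LIMSEQ summ_W)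
  thus "(\<lambda>k. norm (T k)) \<longlonglongrightarrow> 0" by (simp add: tendsto_norm_zero)
qed (simp_all add: mnorm_nonneg mnorm_le_norm)

lemma T_small: "0 < e \<Longrightarrow> \<forall>\<^sub>F k in sequentially. mnorm (T k) \<le> e"
  using order_tendstoD(2)[OF T_lim, of e] by (auto elim: eventually_mono)

definition Y :: "nat \<Rightarrow> 'n mat" where "Y k = PP k + T k"

text \<open>The Riccati operator is evaluated at \<open>Y\<close> instead of \<open>PP\<close>; the
  discrepancy is booked as an additional perturbation, which vanishes with the tails as long as the
  iterates are bounded.\<close>

definition E :: "nat \<Rightarrow> 'n mat" where
  "E k = D k (PP k) + (ric (PP k) - ric (Y k))"

lemma symm_Y: "symm (Y k)"
  unfolding Y_def by (intro symm_add symm_PP symm_T)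

text \<open>Stated for the trial iterate, hence valid whether or not a reset follows. It can
  therefore be used to show that the trial iterate passes the reset test.\<close>

lemma half_T: "half k + T (Suc k) = Y k + h k *\<^sub>R (ric (Y k) + E k)"
  unfolding half_def Y_def E_def T_Suc[of k] by (simp add: algebra_simps)

lemma mnorm_E: "mnorm (E k) \<le> mnorm (D k (PP k)) + mnorm (ric (PP k) - ric (PP k + T k))"
  unfolding E_def Y_def by (rule mnorm_add)

lemma ric_diff_small:
  assumes "0 < e"
  shows "\<forall>\<^sub>F k in sequentially. \<forall>X. mnorm X \<le> L \<longrightarrow> mnorm (ric X - ric (X + T k)) \<le> e"
proof -
  define C where "C = mnorm (transpose A) + mnorm A + mnorm S * (2 * L + 1)"
  have "(\<lambda>k. mnorm (T k) * C) \<longlonglongrightarrow> 0"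
    using tendsto_mult_left_zero[OF T_lim] by blast
  from order_tendstoD(2)[OF this assms] T_small[OF zero_less_one] show ?thesis
  proof eventually_elim
    case (elim k)
    show ?case using elim mnorm_ric_diff[of _ L "T k"] unfolding C_def by fastforce
  qed
qed

section \<open>Finiteness of the resets\<close>

lemmas dl_pos = tolerance_pos[OF b] and dl_eq = tolerance_eq[OF b]

lemma T_loewner:
  assumes "mnorm (T k) \<le> c * r"
  shows "Y k \<preceq> g *\<^sub>R P \<Longrightarrow> PP k \<preceq> (g + c) *\<^sub>R P" "g *\<^sub>R P \<preceq> Y k \<Longrightarrow> (g - c) *\<^sub>R P \<preceq> PP k"
  using loewner_diff(1)[of "Y k" g "- c" "T k"] loewner_diff(2)[of g "Y k" "T k" c]
    loewner_of_mnorm[OF assms] by (simp_all add: Y_def)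

text \<open>Once steps and tails are small, \<open>box (2 * s) b\<close> is invariant for
  \<open>Y\<close>, so the trial iterates stay in \<open>box s (b + s)\<close>; they are positive
  definite there and below the threshold when \<open>qq\<close> is large. Smallness of
  \<open>D\<close> is assumed only inside that interval, which makes the lemma available for both
  parts of the theorem.\<close>

lemma restart_stays:
  assumes D: "\<forall>\<^sub>F k in sequentially. PP k \<in> box s (b + s) \<longrightarrow> mnorm (D k (PP k)) \<le> tolerance b * (1 + mnorm (PP k))"
  obtains K0 q0 where "\<And>K k. K0 \<le> K \<Longrightarrow> q0 \<le> qq K \<Longrightarrow> PP K = P0 \<Longrightarrow> K \<le> k \<Longrightarrow> qq k = qq K"
proof -
  define L0 C where "L0 = (b + 1) * mnorm P" and "C = step_const b (b * mnorm P)"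
  have "(\<lambda>k. h k * C) \<longlonglongrightarrow> 0"
    using tendsto_mult_left_zero[OF h_lim] by blast
  hence "\<forall>\<^sub>F k in sequentially. h k * C < q / 16"
    using q_pos by (intro order_tendstoD(2)[of _ 0]) auto
  moreover have "\<forall>\<^sub>F k in sequentially. mnorm (T k) \<le> s * r"
    using s r_pos by (intro T_small) simp
  moreover have "\<forall>\<^sub>F k in sequentially. \<forall>X. mnorm X \<le> L0 \<longrightarrow> mnorm (ric X - ric (X + T k)) \<le> q / 16"
    using q_pos by (intro ric_diff_small) simp
  ultimately have "\<forall>\<^sub>F k in sequentially. h k * C < q / 16 \<and> mnorm (T k) \<le> s * r
      \<and> (\<forall>X. mnorm X \<le> L0 \<longrightarrow> mnorm (ric X - ric (X + T k)) \<le> q / 16)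
      \<and> (PP k \<in> box s (b + s) \<longrightarrow> mnorm (D k (PP k)) \<le> tolerance b * (1 + mnorm (PP k)))"
    using D by eventually_elim auto
  then obtain K0 where K0: "\<And>k. K0 \<le> k \<Longrightarrow> h k * C < q / 16" "\<And>k. K0 \<le> k \<Longrightarrow> mnorm (T k) \<le> s * r"
      "\<And>k X. K0 \<le> k \<Longrightarrow> mnorm X \<le> L0 \<Longrightarrow> mnorm (ric X - ric (X + T k)) \<le> q / 16"
      "\<And>k. K0 \<le> k \<Longrightarrow> PP k \<in> box s (b + s) \<Longrightarrow> mnorm (D k (PP k)) \<le> tolerance b * (1 + mnorm (PP k))"
    unfolding eventually_sequentially by blast
  have "\<forall>\<^sub>F k in sequentially. L0 \<le> Bq k" using Bq_lim unfolding filterlim_at_top by blast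
  then obtain q0 where q0: "\<And>k. q0 \<le> k \<Longrightarrow> L0 \<le> Bq k" unfolding eventually_sequentially by blast
  have L0: "mnorm X \<le> L0" if "X \<in> box s (b + s)" for X
  proof -
    have "mnorm X \<le> (b + s) * mnorm P" using that s b by (intro box_mnorm) auto
    also have "\<dots> \<le> L0" unfolding L0_def using s by (intro mult_right_mono mnorm_nonneg) auto
    finally show ?thesis .
  qed
  have "qq k = qq K \<and> Y k \<in> box (2 * s) b" if K: "K0 \<le> K" "q0 \<le> qq K" "PP K = P0" and "K \<le> k" for K k
    using \<open>K \<le> k\<close>
  proof (induction k rule: dec_induct)
    case base
    have "Y K \<preceq> (b - s + s) *\<^sub>R P" "(3 * s + - s) *\<^sub>R P \<preceq> Y K"
      unfolding Y_def K(3) using loewner_of_mnorm[OF K0(2)[OF K(1)]] P0_box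
      by (intro loewner_add; simp add: box_def)+
    thus ?case using symm_Y by (simp add: box_def)
  next
    case (step k)
    have k: "K0 \<le> k" "K0 \<le> Suc k" using step(1) K(1) by auto
    have Yb: "(2 * s) *\<^sub>R P \<preceq> Y k" "Y k \<preceq> b *\<^sub>R P" "Y k \<in> box (2 * s) b"
      using step.IH by (auto simp: box_def)
    have PPb: "PP k \<in> box s (b + s)"
      using T_loewner(1)[OF K0(2)[OF k(1)] Yb(2)] T_loewner(2)[OF K0(2)[OF k(1)] Yb(1)] symm_PP
      by (simp add: box_def)
    have "mnorm (D k (PP k)) \<le> tolerance b * (1 + mnorm (PP k))" by (rule K0(4)[OF k(1) PPb])
    also have "\<dots> \<le> tolerance b * (1 + L0)" using dl_pos L0[OF PPb] by (intro mult_left_mono) auto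
    also have "\<dots> = q / 8" unfolding L0_def by (rule dl_eq)
    finally have "mnorm (E k) \<le> q / 8 + q / 16"
      using mnorm_E[of k] K0(3)[OF k(1) L0[OF PPb]] by linarith
    \<comment> \<open>The budget: \<open>q / 8\<close> for the perturbation, \<open>q / 16\<close>
      for the shift by the tail, \<open>q / 16\<close> for the step size. The total
      \<open>q / 4\<close> is what the lower margin \<open>(1 - 2 * s) * (q / 2)\<close> guarantees
      for \<open>s \<le> 1 / 4\<close>.\<close>
    hence small: "mnorm (E k) + h k * C \<le> q / 4" using K0(1)[OF k(1)] by linarith
    have YL: "mnorm (Y k) \<le> b * mnorm P" using s b by (intro box_mnorm[OF Yb(3)]) auto
    have "q / 4 \<le> (b - 1) * q" using b q_pos by (simp add: field_simps)
    \<comment> \<open>Invariance is the aim, not improvement, so the one-step lemmas are used with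
      speed \<open>c = 0\<close>.\<close>
    hence up: "Y k + h k *\<^sub>R (ric (Y k) + E k) \<preceq> (b - h k * 0) *\<^sub>R P"
      using small b h_pos[of k] unfolding C_def
      by (intro upper_step[OF symm_Y Yb(2) _ order_refl YL]) auto
    have "q / 4 \<le> (1 - 2 * s) * (q / 2)"
      using mult_right_mono[of "1 / 2" "1 - 2 * s" "q / 2"] s q_pos by simp
    hence "0 * mnorm P + mnorm (E k) + h k * C \<le> (1 - 2 * s) * (q / 2)" using small by simp
    moreover have "- (2 * s) * (mnorm S * mnorm P ^ 2) \<le> 0"
      using s mnorm_nonneg[of S] by simp
    hence "- (2 * s) * (mnorm S * mnorm P ^ 2) \<le> q / 2" using q_pos by linarith
    ultimately have "(2 * s + h k * 0) *\<^sub>R P \<preceq> Y k + h k *\<^sub>R (ric (Y k) + E k)"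
      using s b h_pos[of k] unfolding C_def
      by (intro lower_step[where G = b, OF symm_Y Yb(1) _ _ YL]) auto
    with up have Yn: "half k + T (Suc k) \<preceq> b *\<^sub>R P" "(2 * s) *\<^sub>R P \<preceq> half k + T (Suc k)"
      unfolding half_T by simp_all
    have "half k \<preceq> (b - - s) *\<^sub>R P" "(2 * s - s) *\<^sub>R P \<preceq> half k"
      using loewner_diff(1)[OF Yn(1) loewner_of_mnorm(2)[OF K0(2)[OF k(2)]]]
        loewner_diff(2)[OF Yn(2) loewner_of_mnorm(1)[OF K0(2)[OF k(2)]]] by simp_all
    moreover have "symm (half k)"
      unfolding half_def by (intro symm_add symm_scaleR symm_PP symm_ric symm_D symm_W)
    ultimately have hb: "half k \<in> box s (b + s)" by (simp add: box_def)
    show ?case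
    proof (cases rule: step_cases[of k])
      case Reset
      have "mnorm (half k) \<le> Bq (qq k)"
        using L0[OF hb] q0[of "qq k"] step.IH K(2) by fastforce
      with Reset(1) box_posdef[OF hb s(1)] show ?thesis by auto
    next
      case Keep
      thus ?thesis using step.IH Yn symm_Y[of "Suc k"] by (simp add: box_def Y_def)
    qed
  qed
  thus thesis using that by blast
qed

lemma qq_mono: "j \<le> k \<Longrightarrow> qq j \<le> qq k"
  by (rule lift_Suc_mono_le[of qq]) (metis step_cases le_Suc_eq order_refl)

lemma finite_resets:
  assumes D: "\<forall>\<^sub>F k in sequentially. PP k \<in> box s (b + s) \<longrightarrow> mnorm (D k (PP k)) \<le> tolerance b * (1 + mnorm (PP k))"
  obtains K where "\<And>k. K \<le> k \<Longrightarrow> qq k = qq K"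
proof -
  obtain K0 q0 where K0: "\<And>K k. K0 \<le> K \<Longrightarrow> q0 \<le> qq K \<Longrightarrow> PP K = P0 \<Longrightarrow> K \<le> k \<Longrightarrow> qq k = qq K"
    using restart_stays[OF D] by blast
  show thesis
  proof (cases "\<exists>k. max q0 (Suc (qq K0)) \<le> qq k")
    case True
    \<comment> \<open>The first time the index reaches this level is a reset time, so the iterate is
      \<open>P0\<close> there. Exceeding \<open>qq K0\<close> places it after \<open>K0\<close>,
      since \<open>qq\<close> is monotone.\<close>
    define k where "k = (LEAST k. max q0 (Suc (qq K0)) \<le> qq k)"
    have k: "max q0 (Suc (qq K0)) \<le> qq k" unfolding k_def by (rule LeastI_ex[OF True])
    have kK: "K0 < k" using k qq_mono[of k K0] by (cases "K0 < k") auto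
    then obtain j where j: "k = Suc j" by (cases k) auto
    have "\<not> max q0 (Suc (qq K0)) \<le> qq j" using not_less_Least[of j] k_def j by (metis lessI)
    hence "PP k = P0" using k j by (cases rule: step_cases[of j]) auto
    thus thesis using kK k by (intro that[of k] K0) auto
  next
    case False
    hence "\<forall>y \<in> range qq. y \<le> max q0 (Suc (qq K0))" by (metis imageE linear)
    hence "finite (range qq)" using finite_nat_set_iff_bounded_le by blast
    moreover have "range qq \<noteq> {}" by simp
    ultimately have "Max (range qq) \<in> range qq" by (rule Max_in)
    then obtain K where K: "qq K = Max (range qq)" by (metis imageE)
    have "qq k = qq K" if "K \<le> k" for k
      using qq_mono[OF that] Max_ge[OF \<open>finite (range qq)\<close>, of "qq k"] K by simp
    thus thesis by (rule that)
  qed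
qed

text \<open>The bound on \<open>PP k\<close> comes from the test passed at step
  \<open>k - 1\<close>, which explains the start at \<open>Suc K\<close>. It is the path-dependent a
  priori bound.\<close>

lemma eventually_no_reset:
  assumes K: "\<And>k. K \<le> k \<Longrightarrow> qq k = qq K" and k: "Suc K \<le> k"
  shows "Y (Suc k) = Y k + h k *\<^sub>R (ric (Y k) + E k)" and "mnorm (PP k) \<le> Bq (qq K)"
proof -
  have keep: "PP (Suc j) = half j \<and> mnorm (half j) \<le> Bq (qq K)" if "K \<le> j" for j
    using K[of j] K[of "Suc j"] that by (cases rule: step_cases[of j]) auto
  show "Y (Suc k) = Y k + h k *\<^sub>R (ric (Y k) + E k)"
    using keep[of k] k half_T[of k] by (simp add: Y_def)
  show "mnorm (PP k) \<le> Bq (qq K)"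
    using k keep[of "k - 1"] by (cases k) auto
qed

text \<open>The upper bound must be reached first: only then is the relative perturbation
  tolerance b * (1 + |PP k|) small in absolute terms, which the lower bound requires.\<close>

lemma eventually_between:
  assumes K: "\<And>k. K \<le> k \<Longrightarrow> qq k = qq K" and m: "0 < m" and a: "0 \<le> a" and c: "0 \<le> c"
    and up: "\<forall>\<^sub>F k in sequentially. \<forall>g\<ge>c. PP k \<preceq> (g + s) *\<^sub>R P \<longrightarrow> mnorm (D k (PP k)) + 2 * m \<le> (g - 1) * q"
    and low: "\<forall>\<^sub>F k in sequentially. PP k \<preceq> (c + s) *\<^sub>R P \<longrightarrow> mnorm (D k (PP k)) + 2 * m \<le> (1 - a) * (q / 2)"
  shows "\<forall>\<^sub>F k in sequentially. a *\<^sub>R P \<preceq> Y k \<and> Y k \<preceq> c *\<^sub>R P"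
proof -
  \<comment> \<open>Chosen to meet the requirement of \<open>lower_eventually\<close> on the
    starting coefficient \<open>- d\<close>.\<close>
  define d where "d = q / (2 * (mnorm S * mnorm P ^ 2 + 1))"
  have "0 \<le> mnorm S * mnorm P ^ 2" by (simp add: mnorm_nonneg)
  hence d: "0 < d" "d * (mnorm S * mnorm P ^ 2) \<le> q / 2"
    using q_pos by (simp_all add: d_def field_simps)
  let ?L = "Bq (qq K) + 1"
  have h: "\<And>k. 0 \<le> h k" using h_pos by (simp add: less_imp_le)
  have "\<forall>\<^sub>F k in sequentially. mnorm (T k) \<le> s * r \<and> mnorm (T k) \<le> d * r \<and> mnorm (T k) \<le> 1
      \<and> (\<forall>X. mnorm X \<le> Bq (qq K) \<longrightarrow> mnorm (ric X - ric (X + T k)) \<le> m)"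
    using s d r_pos m by (intro eventually_conj T_small ric_diff_small) auto
  with up low have "\<forall>\<^sub>F k in sequentially. mnorm (T k) \<le> s * r \<and> mnorm (T k) \<le> d * r \<and> mnorm (T k) \<le> 1
      \<and> (\<forall>X. mnorm X \<le> Bq (qq K) \<longrightarrow> mnorm (ric X - ric (X + T k)) \<le> m)
      \<and> (\<forall>g\<ge>c. PP k \<preceq> (g + s) *\<^sub>R P \<longrightarrow> mnorm (D k (PP k)) + 2 * m \<le> (g - 1) * q)
      \<and> (PP k \<preceq> (c + s) *\<^sub>R P \<longrightarrow> mnorm (D k (PP k)) + 2 * m \<le> (1 - a) * (q / 2))"
    by eventually_elim blast
  then obtain N0 where N0: "\<And>k. N0 \<le> k \<Longrightarrow> mnorm (T k) \<le> s * r" "\<And>k. N0 \<le> k \<Longrightarrow> mnorm (T k) \<le> d * r"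
      "\<And>k. N0 \<le> k \<Longrightarrow> mnorm (T k) \<le> 1"
      "\<And>k X. N0 \<le> k \<Longrightarrow> mnorm X \<le> Bq (qq K) \<Longrightarrow> mnorm (ric X - ric (X + T k)) \<le> m"
      "\<And>k g. N0 \<le> k \<Longrightarrow> c \<le> g \<Longrightarrow> PP k \<preceq> (g + s) *\<^sub>R P \<Longrightarrow> mnorm (D k (PP k)) + 2 * m \<le> (g - 1) * q"
      "\<And>k. N0 \<le> k \<Longrightarrow> PP k \<preceq> (c + s) *\<^sub>R P \<Longrightarrow> mnorm (D k (PP k)) + 2 * m \<le> (1 - a) * (q / 2)"
    unfolding eventually_sequentially by blast
  define N where "N = max N0 (Suc K)"
  have N: "N0 \<le> k" "Suc K \<le> k" if "N \<le> k" for k using that by (auto simp: N_def)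
  have rec: "Y (Suc k) = Y k + h k *\<^sub>R (ric (Y k) + E k)" if "N \<le> k" for k
    by (rule eventually_no_reset(1)[OF K N(2)[OF that]])
  have PPb: "mnorm (PP k) \<le> Bq (qq K)" if "N \<le> k" for k
    by (rule eventually_no_reset(2)[OF K N(2)[OF that]])
  have bdd: "mnorm (Y k) \<le> ?L" if "N \<le> k" for k
    using mnorm_add[of "PP k" "T k"] PPb[OF that] N0(3)[OF N(1)[OF that]] by (simp add: Y_def)
  have mE: "mnorm (E k) \<le> mnorm (D k (PP k)) + m" if "N \<le> k" for k
    using mnorm_E[of k] N0(4)[OF N(1)[OF that] PPb[OF that]] by linarith
  have "\<forall>\<^sub>F k in sequentially. Y k \<preceq> c *\<^sub>R P"
  proof (rule upper_eventually[where Y = Y and E = E and K = N, OF rec symm_Y bdd h h_lim h_div m])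
    fix k g assume k: "N \<le> k" "c \<le> g" "Y k \<preceq> g *\<^sub>R P"
    have "PP k \<preceq> (g + s) *\<^sub>R P" by (rule T_loewner(1)[OF N0(1)[OF N(1)[OF k(1)]] k(3)])
    from N0(5)[OF N(1)[OF k(1)] k(2) this] mE[OF k(1)] show "mnorm (E k) + m \<le> (g - 1) * q"
      by linarith
  qed auto
  then obtain N' where N': "\<And>k. N' \<le> k \<Longrightarrow> Y k \<preceq> c *\<^sub>R P"
    unfolding eventually_sequentially by blast
  have "\<forall>\<^sub>F k in sequentially. a *\<^sub>R P \<preceq> Y k"
  proof (rule lower_eventually[where Y = Y and E = E and K = "max N N'" and d = d,
        OF rec symm_Y bdd h h_lim h_div m])
    fix k assume k: "max N N' \<le> k"
    hence kN: "N \<le> k" "N' \<le> k" by auto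
    have "PP k \<preceq> (c + s) *\<^sub>R P" by (rule T_loewner(1)[OF N0(1)[OF N(1)[OF kN(1)]] N'[OF kN(2)]])
    from N0(6)[OF N(1)[OF kN(1)] this] mE[OF kN(1)] show "mnorm (E k) + m \<le> (1 - a) * (q / 2)"
      by linarith
    \<comment> \<open>The iterate is positive semidefinite and the tail is at least
      \<open>- d\<close> times \<open>P\<close>, so the noise-free sequence starts the lower climb
      at \<open>- d\<close>.\<close>
    have "(0 + - d) *\<^sub>R P \<preceq> Y k"
      unfolding Y_def
      by (rule loewner_add(2)[OF PP_nonneg loewner_of_mnorm(2)[OF N0(2)[OF N(1)[OF kN(1)]]]])
    thus "- d *\<^sub>R P \<preceq> Y k" by simp
  qed (use d a in auto)
  moreover have "\<forall>\<^sub>F k in sequentially. Y k \<preceq> c *\<^sub>R P"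
    using N' unfolding eventually_sequentially by blast
  ultimately show ?thesis by eventually_elim blast
qed

theorem eventually_in_box:
  assumes D: "\<And>k. mnorm (D k (PP k)) \<le> tolerance b * (1 + mnorm (PP k))"
  shows "\<forall>\<^sub>F k in sequentially. PP k \<in> box s (b + s)"
proof -
  obtain K where K: "\<And>k. K \<le> k \<Longrightarrow> qq k = qq K"
    using finite_resets D by (metis (mono_tags, lifting) always_eventually)
  have Dg: "mnorm (D k (PP k)) \<le> tolerance b * (1 + (g + 1) * mnorm P)"
    if "0 \<le> g" "PP k \<preceq> (g + s) *\<^sub>R P" for g k
  proof -
    have "PP k \<preceq> (g + 1) *\<^sub>R P" by (rule loewner_scale_mono(1)[OF _ that(2)]) (use s in auto)
    hence "mnorm (PP k) \<le> (g + 1) * mnorm P" using that(1) by (intro mnorm_PP) auto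
    hence "tolerance b * (1 + mnorm (PP k)) \<le> tolerance b * (1 + (g + 1) * mnorm P)"
      using dl_pos by (intro mult_left_mono) auto
    thus ?thesis using D[of k] by linarith
  qed
  have "\<forall>\<^sub>F k in sequentially. (2 * s) *\<^sub>R P \<preceq> Y k \<and> Y k \<preceq> b *\<^sub>R P"
  proof (rule eventually_between[OF K, of "q / 16"])
    show "\<forall>\<^sub>F k in sequentially. \<forall>g\<ge>b. PP k \<preceq> (g + s) *\<^sub>R P \<longrightarrow>
        mnorm (D k (PP k)) + 2 * (q / 16) \<le> (g - 1) * q"
    proof (intro always_eventually allI impI)
      fix k g assume g: "b \<le> g" "PP k \<preceq> (g + s) *\<^sub>R P"
      have p: "0 \<le> mnorm P" by (rule mnorm_nonneg)
      \<comment> \<open>Going from level \<open>b\<close> to level \<open>g\<close> multiplies the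
        perturbation bound by at most \<open>g\<close>. The resulting \<open>g * (q / 8)\<close>
        plus the extra \<open>q / 8\<close> is below \<open>(g - 1) * q\<close> because
        \<open>g \<ge> 3\<close>.\<close>
      have "(g + 1) * mnorm P \<le> g * ((b + 1) * mnorm P)"
      proof -
        have "g * 1 \<le> g * b" using b g by (intro mult_left_mono) auto
        moreover have "1 \<le> g" using b g by simp
        ultimately have "g + 1 \<le> g * (b + 1)" unfolding distrib_left by linarith
        hence "(g + 1) * mnorm P \<le> g * (b + 1) * mnorm P" using p by (intro mult_right_mono) auto
        thus ?thesis by (simp add: mult.assoc)
      qed
      hence "1 + (g + 1) * mnorm P \<le> g * (1 + (b + 1) * mnorm P)"
        using b g by (simp add: distrib_left)
      hence "tolerance b * (1 + (g + 1) * mnorm P) \<le> tolerance b * (g * (1 + (b + 1) * mnorm P))"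
        using dl_pos by (intro mult_left_mono) auto
      also have "\<dots> = g * (tolerance b * (1 + (b + 1) * mnorm P))" by simp
      also have "\<dots> = g * (q / 8)" unfolding dl_eq ..
      finally have "mnorm (D k (PP k)) \<le> g * (q / 8)" using Dg[of g k] g b by simp
      moreover have "3 * q \<le> g * q" using g b q_pos by (intro mult_right_mono) auto
      ultimately show "mnorm (D k (PP k)) + 2 * (q / 16) \<le> (g - 1) * q"
        using q_pos unfolding left_diff_distrib by linarith
    qed
    show "\<forall>\<^sub>F k in sequentially. PP k \<preceq> (b + s) *\<^sub>R P \<longrightarrow>
        mnorm (D k (PP k)) + 2 * (q / 16) \<le> (1 - 2 * s) * (q / 2)"
    proof (intro always_eventually allI impI)
      fix k assume "PP k \<preceq> (b + s) *\<^sub>R P"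
      \<comment> \<open>Below level \<open>b\<close> the tolerance gives an absolute bound, and
        \<open>q / 8 + 2 * (q / 16)\<close> is exactly the guaranteed margin
        \<open>q / 4\<close>.\<close>
      hence "mnorm (D k (PP k)) \<le> q / 8" using Dg[of b k] b dl_eq by simp
      moreover have "q / 4 \<le> (1 - 2 * s) * (q / 2)"
        using mult_right_mono[of "1 / 2" "1 - 2 * s" "q / 2"] s q_pos by simp
      ultimately show "mnorm (D k (PP k)) + 2 * (q / 16) \<le> (1 - 2 * s) * (q / 2)" by linarith
    qed
  qed (use q_pos s b in auto)
  moreover have "\<forall>\<^sub>F k in sequentially. mnorm (T k) \<le> s * r"
    using s r_pos by (intro T_small) simp
  ultimately show ?thesis
  proof eventually_elim
    case (elim k)
    thus ?case using T_loewner[OF elim(2)] symm_PP by (fastforce simp: box_def)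
  qed
qed

text \<open>Smallness of \<open>D\<close> on bounded sets helps only once the iterates are bounded.
  Applied inside the fixed interval it yields finitely many resets; then \<open>Bq (qq K)\<close>
  bounds the iterates, so \<open>D k (PP k)\<close> vanishes and \<open>eventually_between\<close>
  works for arbitrarily narrow intervals around \<open>P\<close>.\<close>

theorem PP_tendsto:
  assumes D: "\<And>L e. 0 < e \<Longrightarrow>
    \<forall>\<^sub>F k in sequentially. \<forall>X. symm X \<and> mnorm X \<le> L \<longrightarrow> mnorm (D k X) \<le> e"
  shows "PP \<longlonglongrightarrow> P"
proof -
  have "\<forall>\<^sub>F k in sequentially. PP k \<in> box s (b + s) \<longrightarrow> mnorm (D k (PP k)) \<le> tolerance b * (1 + mnorm (PP k))"
    using D[OF dl_pos, of "(b + s) * mnorm P"]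
  proof eventually_elim
    case (elim k)
    show ?case
    proof
      assume "PP k \<in> box s (b + s)"
      hence "mnorm (PP k) \<le> (b + s) * mnorm P" using s b by (intro box_mnorm) auto
      hence "mnorm (D k (PP k)) \<le> tolerance b * 1" using elim symm_PP by simp
      also have "\<dots> \<le> tolerance b * (1 + mnorm (PP k))"
        using dl_pos mnorm_nonneg by (intro mult_left_mono) auto
      finally show "mnorm (D k (PP k)) \<le> tolerance b * (1 + mnorm (PP k))" .
    qed
  qed
  then obtain K where K: "\<And>k. K \<le> k \<Longrightarrow> qq k = qq K"
    using finite_resets by blast
  have D0: "\<forall>\<^sub>F k in sequentially. mnorm (D k (PP k)) \<le> e" if "0 < e" for e
    using D[OF that, of "Bq (qq K)"] eventually_ge_at_top[of "Suc K"]
    by eventually_elim (use eventually_no_reset(2)[OF K] symm_PP in blast)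
  have near: "\<forall>\<^sub>F k in sequentially. mnorm (Y k - P) \<le> e * mnorm P" if e: "0 < e" "e \<le> 1" for e
  proof -
    have "\<forall>\<^sub>F k in sequentially. (1 - e) *\<^sub>R P \<preceq> Y k \<and> Y k \<preceq> (1 + e) *\<^sub>R P"
    proof (rule eventually_between[OF K, of "e * q / 8"])
      \<comment> \<open>Perturbation plus reserve amount to 3/8 of \<open>e * q\<close>, below the
        upper margin \<open>e * q\<close> and the lower margin \<open>e * q / 2\<close>.\<close>
      have De: "\<forall>\<^sub>F k in sequentially. mnorm (D k (PP k)) \<le> e * q / 8"
        using e q_pos by (intro D0) simp
      have eq: "0 < e * q" using e q_pos by simp
      show "\<forall>\<^sub>F k in sequentially. \<forall>g\<ge>1 + e. PP k \<preceq> (g + s) *\<^sub>R P \<longrightarrow>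
          mnorm (D k (PP k)) + 2 * (e * q / 8) \<le> (g - 1) * q"
        using De
      proof (eventually_elim, intro allI impI)
        fix k g assume "mnorm (D k (PP k)) \<le> e * q / 8" "1 + e \<le> g"
        moreover from this have "e * q \<le> (g - 1) * q" using q_pos by (intro mult_right_mono) auto
        ultimately show "mnorm (D k (PP k)) + 2 * (e * q / 8) \<le> (g - 1) * q" using eq by linarith
      qed
      show "\<forall>\<^sub>F k in sequentially. PP k \<preceq> (1 + e + s) *\<^sub>R P \<longrightarrow>
          mnorm (D k (PP k)) + 2 * (e * q / 8) \<le> (1 - (1 - e)) * (q / 2)"
        using De by eventually_elim (use eq in auto)
    qed (use e q_pos in auto)
    thus ?thesis
    proof eventually_elim
      case (elim k)
      have PP: "1 *\<^sub>R P \<preceq> P" "P \<preceq> 1 *\<^sub>R P" by (simp_all add: loewner_le_def)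
      have "Y k - P \<preceq> (1 + e - 1) *\<^sub>R P" "(1 - e - 1) *\<^sub>R P \<preceq> Y k - P"
        using elim PP by (intro loewner_diff; blast)+
      thus ?case using e by (intro mnorm_of_loewner symm_diff symm_Y symm_P) auto
    qed
  qed
  have Ylim: "(\<lambda>k. mnorm (Y k - P)) \<longlonglongrightarrow> 0"
  proof (rule tendstoI)
    fix e :: real assume "0 < e"
    define d where "d = min 1 (e / (2 * (mnorm P + 1)))"
    have p: "0 < mnorm P + 1" using mnorm_nonneg[of P] by simp
    have d: "0 < d" "d \<le> 1" using \<open>0 < e\<close> p by (auto simp: d_def)
    have "d * mnorm P \<le> d * (mnorm P + 1)" using d by simp
    also have "\<dots> \<le> e / (2 * (mnorm P + 1)) * (mnorm P + 1)"
      using p by (intro mult_right_mono) (auto simp: d_def)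
    also have "\<dots> = e / 2" using p by (simp add: field_simps)
    finally have "d * mnorm P < e" using \<open>0 < e\<close> by linarith
    with near[OF d] show "\<forall>\<^sub>F k in sequentially. dist (mnorm (Y k - P)) 0 < e"
      by (auto elim!: eventually_mono simp: mnorm_nonneg)
  qed
  have lim: "(\<lambda>k. real CARD('n) ^ 2 * (mnorm (Y k - P) + mnorm (T k))) \<longlonglongrightarrow> 0"
    by (intro tendsto_mult_right_zero tendsto_add_zero Ylim T_lim)
  have le: "norm (PP k - P) \<le> real CARD('n) ^ 2 * (mnorm (Y k - P) + mnorm (T k))" for k
  proof -
    have "mnorm (PP k - P) \<le> mnorm (Y k - P) + mnorm (T k)"
      using mnorm_diff[of "Y k - P" "T k"] by (simp add: Y_def algebra_simps)
    from order_trans[OF norm_le_mnorm mult_left_mono[OF this zero_le_power2]] show ?thesis .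
  qed
  have "(\<lambda>k. PP k - P) \<longlonglongrightarrow> 0"
    by (rule Lim_null_comparison[OF always_eventually[OF allI[OF le]] lim])
  thus ?thesis by (simp add: LIM_zero_iff)
qed

end

section \<open>The two statements, path by path\<close>

theorem mainTheorem7:
  fixes A :: "real^'n::finite^'n" and B :: "real^'m::finite^'n"
    and Q :: "real^'n^'n" and R :: "real^'m^'m" and Pstar :: "real^'n^'n"
    and h :: "nat \<Rightarrow> real" and Bq :: "nat \<Rightarrow> real" and P0 :: "real^'n^'n"
    and M :: "'a measure" and F :: "nat \<Rightarrow> 'a measure"
    and W :: "nat \<Rightarrow> 'a \<Rightarrow> real^'n^'n"
  assumes stab: "stabilizable A B"
    and R_pd: "posdef R"
    and Q_pd: "posdef Q"
    and Pstar_pd: "posdef Pstar"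
    and Pstar_are: "riccati A B Q R Pstar = 0"
    and h_pos: "\<And>k. h k > 0"
    and h_lim: "h \<longlonglongrightarrow> 0"
    and h_div: "filterlim (\<lambda>n. \<Sum>k<n. h k) at_top sequentially"
    and Bq_mono: "mono Bq"
    and Bq_pos: "Bq 0 > 0"
    and Bq_lim: "filterlim Bq at_top sequentially"
    and P0_pd: "posdef P0"
    and prob: "prob_space M"
    and compl: "complete_measure M"
    and filt: "filtration (space M) F"
    and F_sub: "\<And>k. sets (F k) \<subseteq> sets M"
    and W_adapted: "\<And>k. W k \<in> borel_measurable (F k)"
    and W_sym: "\<And>k \<omega>. symm (W k \<omega>)"
    and W_sum: "AE \<omega> in M. summable (\<lambda>k. h k *\<^sub>R W k \<omega>)"
  shows
    "(\<exists>\<delta>0 S0. \<delta>0 > 0 \<and> compact S0 \<and> S0 \<subseteq> Sym_pos \<and> Pstar \<in> S0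
        \<and> (\<exists>X\<in>S0. \<exists>e>0. \<forall>Y\<in>Sym. dist Y X < e \<longrightarrow> Y \<in> S0)
        \<and> (\<forall>Dl :: 'a \<Rightarrow> nat \<Rightarrow> real^'n^'n \<Rightarrow> real^'n^'n.
             (\<forall>\<omega> k X. symm (Dl \<omega> k X)) \<and>
             (\<forall>\<omega> k. mnorm (Dl \<omega> k (fst (rvi A B Q R h Bq P0 (Dl \<omega>) (\<lambda>j. W j \<omega>) k)))
                       < \<delta>0 * (1 + mnorm (fst (rvi A B Q R h Bq P0 (Dl \<omega>) (\<lambda>j. W j \<omega>) k))))
             \<longrightarrow> (AE \<omega> in M. \<exists>N. \<forall>k\<ge>N.
                    fst (rvi A B Q R h Bq P0 (Dl \<omega>) (\<lambda>j. W j \<omega>) k) \<in> S0)))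
     \<and> (\<forall>D :: nat \<Rightarrow> real^'n^'n \<Rightarrow> real^'n^'n.
          (\<forall>k X. symm X \<longrightarrow> symm (D k X)) \<and>
          (\<forall>k. continuous_on Sym (D k)) \<and>
          (\<forall>K. compact K \<and> K \<subseteq> Sym \<longrightarrow>
               (\<forall>e>0. \<exists>N. \<forall>k\<ge>N. \<forall>X\<in>K. mnorm (D k X) < e))
          \<longrightarrow> (AE \<omega> in M. (\<lambda>k. fst (rvi A B Q R h Bq P0 D (\<lambda>j. W j \<omega>) k)) \<longlonglongrightarrow> Pstar))"
proof -
  define S where "S = B ** matrix_inv R ** transpose B"
  have ric: "riccati A B Q R X = transpose A ** X + X ** A - X ** S ** X + Q" for X
    by (simp add: riccati_def S_def matrix_mul_assoc)
  obtain q where q: "0 < q" "\<And>x. q * (x \<bullet> x) \<le> quadf Q x" using posdef_coercive[OF Q_pd] by blast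
  obtain r where r: "0 < r" "\<And>x. r * (x \<bullet> x) \<le> quadf Pstar x"
    using posdef_coercive[OF Pstar_pd] by blast
  have "symm S" "\<And>x. 0 \<le> quadf S x"
    using posdef_inverse_congruence_psd[OF R_pd, of B] by (simp_all only: S_def)
  have "symm Q" "symm Pstar" using Q_pd Pstar_pd by (simp_all only: posdef_def)
  have "transpose A ** Pstar + Pstar ** A - Pstar ** S ** Pstar + Q = 0"
    using Pstar_are ric by metis
  interpret riccati_solution A Q S Pstar q r
    by (rule riccati_solution.intro; fact)
  \<comment> \<open>Fixed before any sample path or perturbation is chosen, so
    \<open>tolerance b\<close> and the compact set serve all paths.\<close>
  obtain s b where sb: "0 < s" "s \<le> 1 / 4" "3 \<le> b" "P0 \<in> box (3 * s) (b - s)"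
    using posdef_in_box[OF P0_pd] by blast
  \<comment> \<open>\<open>D\<close> is arbitrary here, so in part (i) it can be instantiated by a
    perturbation that depends on \<omega>.\<close>
  have vi: "robust_vi A Q S Pstar q r h Bq P0 D (\<lambda>j. W j \<omega>)
      (\<lambda>k. fst (rvi A B Q R h Bq P0 D (\<lambda>j. W j \<omega>) k))
      (\<lambda>k. snd (rvi A B Q R h Bq P0 D (\<lambda>j. W j \<omega>) k)) s b"
    if "summable (\<lambda>k. h k *\<^sub>R W k \<omega>)" "\<And>k X. symm X \<Longrightarrow> symm (D k X)" for D \<omega>
    using that sb h_pos h_lim h_div Bq_lim P0_pd W_sym
    by unfold_locales (simp_all add: Let_def split_beta ric ric_def)
  let ?S0 = "box s (b + s)"
  have nhd: "\<forall>X\<in>Sym. dist X Pstar < r / 2 \<longrightarrow> X \<in> ?S0"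
  proof (intro ballI impI)
    fix X assume X: "X \<in> Sym" "dist X Pstar < r / 2"
    \<comment> \<open>Both ends of the interval are at distance at least 1/2 from the coefficient 1,
      which gives the radius \<open>r / 2\<close>.\<close>
    have "1 / 2 * r \<le> (1 - s) * r" "1 / 2 * r \<le> (b + s - 1) * r"
      using sb r(1) by (intro mult_right_mono; simp)+
    thus "X \<in> ?S0" using X by (intro box_nhd[of X "r / 2"]) (auto simp: Sym_def)
  qed
  have Pstar_in: "Pstar \<in> ?S0"
    using nhd r(1) Pstar_pd by (auto simp: Sym_def posdef_def)
  have i: "AE \<omega> in M. \<exists>N. \<forall>k\<ge>N. fst (rvi A B Q R h Bq P0 (Dl \<omega>) (\<lambda>j. W j \<omega>) k) \<in> ?S0"
    if sym: "\<forall>\<omega> k X. symm (Dl \<omega> k X)"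
      and small: "\<forall>\<omega> k. mnorm (Dl \<omega> k (fst (rvi A B Q R h Bq P0 (Dl \<omega>) (\<lambda>j. W j \<omega>) k)))
          < tolerance b * (1 + mnorm (fst (rvi A B Q R h Bq P0 (Dl \<omega>) (\<lambda>j. W j \<omega>) k)))"
    for Dl :: "'a \<Rightarrow> nat \<Rightarrow> real^'n^'n \<Rightarrow> real^'n^'n"
    using W_sum
  proof eventually_elim
    case (elim \<omega>)
    interpret robust_vi A Q S Pstar q r h Bq P0 "Dl \<omega>" "\<lambda>j. W j \<omega>"
      "\<lambda>k. fst (rvi A B Q R h Bq P0 (Dl \<omega>) (\<lambda>j. W j \<omega>) k)"
      "\<lambda>k. snd (rvi A B Q R h Bq P0 (Dl \<omega>) (\<lambda>j. W j \<omega>) k)" s b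
      by (rule vi[OF elim]) (simp add: sym)
    show ?case
      using eventually_in_box small unfolding eventually_sequentially by (meson less_imp_le)
  qed
  have ii: "AE \<omega> in M. (\<lambda>k. fst (rvi A B Q R h Bq P0 D (\<lambda>j. W j \<omega>) k)) \<longlonglongrightarrow> Pstar"
    if sym: "\<forall>k X. symm X \<longrightarrow> symm (D k X)"
      and unif: "\<forall>K. compact K \<and> K \<subseteq> Sym \<longrightarrow> (\<forall>e>0. \<exists>N. \<forall>k\<ge>N. \<forall>X\<in>K. mnorm (D k X) < e)"
    for D :: "nat \<Rightarrow> real^'n^'n \<Rightarrow> real^'n^'n"
    using W_sum
  proof eventually_elim
    case (elim \<omega>)
    interpret robust_vi A Q S Pstar q r h Bq P0 D "\<lambda>j. W j \<omega>"
      "\<lambda>k. fst (rvi A B Q R h Bq P0 D (\<lambda>j. W j \<omega>) k)"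
      "\<lambda>k. snd (rvi A B Q R h Bq P0 D (\<lambda>j. W j \<omega>) k)" s b
      by (rule vi[OF elim]) (simp add: sym)
    show ?case
    proof (rule PP_tendsto)
      fix L e :: real assume e: "0 < e"
      \<comment> \<open>A compact set containing every symmetric matrix of operator norm at most
        \<open>L\<close>; the radius is the constant of \<open>norm_le_mnorm\<close>.\<close>
      define K where "K = cball 0 (real CARD('n) ^ 2 * L) \<inter> {X :: real^'n^'n. symm X}"
      have "compact K" unfolding K_def by (intro compact_Int_closed closed_symm compact_cball)
      moreover have "K \<subseteq> Sym" by (auto simp: K_def Sym_def)
      ultimately obtain N where N: "\<And>k X. k \<ge> N \<Longrightarrow> X \<in> K \<Longrightarrow> mnorm (D k X) < e"
        using unif[rule_format, of K e] e by auto
      have "X \<in> K" if "symm X" "mnorm X \<le> L" for X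
        using order_trans[OF norm_le_mnorm mult_left_mono[OF that(2) zero_le_power2]] that(1)
        by (simp add: K_def)
      thus "\<forall>\<^sub>F k in sequentially. \<forall>X. symm X \<and> mnorm X \<le> L \<longrightarrow> mnorm (D k X) \<le> e"
        unfolding eventually_sequentially using N by (auto intro!: exI[of _ N] less_imp_le)
    qed
  qed
  show ?thesis
  proof (intro conjI)
    show "\<exists>\<delta>0 S0. \<delta>0 > 0 \<and> compact S0 \<and> S0 \<subseteq> Sym_pos \<and> Pstar \<in> S0
        \<and> (\<exists>X\<in>S0. \<exists>e>0. \<forall>Y\<in>Sym. dist Y X < e \<longrightarrow> Y \<in> S0)
        \<and> (\<forall>Dl :: 'a \<Rightarrow> nat \<Rightarrow> real^'n^'n \<Rightarrow> real^'n^'n.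
             (\<forall>\<omega> k X. symm (Dl \<omega> k X)) \<and>
             (\<forall>\<omega> k. mnorm (Dl \<omega> k (fst (rvi A B Q R h Bq P0 (Dl \<omega>) (\<lambda>j. W j \<omega>) k)))
                       < \<delta>0 * (1 + mnorm (fst (rvi A B Q R h Bq P0 (Dl \<omega>) (\<lambda>j. W j \<omega>) k))))
             \<longrightarrow> (AE \<omega> in M. \<exists>N. \<forall>k\<ge>N.
                    fst (rvi A B Q R h Bq P0 (Dl \<omega>) (\<lambda>j. W j \<omega>) k) \<in> S0))"
    proof (intro exI[of _ "tolerance b"] exI[of _ ?S0] conjI)
      show "compact ?S0" using sb by (intro compact_box) auto
      show "?S0 \<subseteq> Sym_pos" using box_posdef sb(1) by (auto simp: Sym_pos_def)
      show "\<exists>X\<in>?S0. \<exists>e>0. \<forall>Y\<in>Sym. dist Y X < e \<longrightarrow> Y \<in> ?S0"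
        using nhd Pstar_in r(1) half_gt_zero by blast
    qed (use i Pstar_in tolerance_pos[OF sb(3)] in blast)+
  qed (use ii in blast)
qed

end
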